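(* Let $A$ be an invertible real $n\times n$ matrix, let $0\le\alpha<n$, $1<p<\frac n\alpha$ and $\frac1q=\frac1p-\frac\alpha n$, and let $w$ be a weight on $\mathbb{R}^n$. The weight $w\in\mathcal{M}_{\alpha,A,p,q}$ if, and only if, $$\Big(\int_{\mathbb{R}^n}M_{\alpha,A^{-1}}(g)^q\,w^q\Big)^{1/q}\le C_{n,p,\alpha}\,[w]_{\mathcal{M}_{\alpha,A,p,q}}\Big(\int_{\mathbb{R}^n}|g|^p\,w^p\Big)^{1/p}$$ for $g=f\,w^{-p'}\in L^p(w^p)$, where $[w]_{\mathcal{M}_{\alpha,A,p,q}}:=[w_A^q,w^{-p'}]_{\mathcal{M}_{\alpha,p,q}}$.
   Context: A weight is a nonnegative function in $L^1_{loc}(\mathbb{R}^n)$; $w_A(x):=w(Ax)$; $\frac1p+\frac1{p'}=1$; $n/\alpha=\infty$ if $\alpha=0$. $C_{n,p,\alpha}$ denotes a constant depending on $n,p,\alpha$. $Q$ denotes cubes in $\mathbb{R}^n$, and $v(Q)=\int_Q v$. The maximal operators are $$M_\alpha f(x)=\sup_{Q\ni x}\frac1{|Q|^{1-\alpha/n}}\int_Q|f(y)|\,dy,\qquad M_{\alpha,A^{-1}}f(x)=M_\alpha f(A^{-1}x).$$ For $1<p\le q<\infty$, a pair of weights $(u,v)$ belongs to $\mathcal{M}_{\alpha,p,q}$ if it satisfies the testing condition $$[u,v]_{\mathcal{M}_{\alpha,p,q}}=\sup_Q v(Q)^{-1/p}\Big(\int_Q M_\alpha(\chi_Q v)^q\,u\Big)^{1/q}<\infty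 .$$ We say $w\in\mathcal{M}_{\alpha,A,p,q}$ if $(w_A^q,w^{-p'})\in\mathcal{M}_{\alpha,p,q}$.
   Formalization: The constant is C_{n,p,α}|det A|^{1/q} instead of C_{n,p,α}, since the printed bound fails for α=0, w=1, A=tI with t large; w=0 a.e. is excluded, since there the inequality holds trivially but w^{-p'} is not a weight. *)

theory Defs
  imports "HOL-Analysis.Analysis"
begin

text \<open>
  Weights, moduli of functions and maximal functions take values in \<^typ>\<open>ennreal\<close>, with the
  measure-theoretic convention \<^term>\<open>0 * \<infinity> = (0::ennreal)\<close>.
\<close>

(* Real powers on [0, \<infinity>]; in particular w^(-p') is \<infinity> where w vanishes
   (whereas powr on the reals has 0 powr a = 0 also for negative a). *)
definition epowr :: "ennreal \<Rightarrow> real \<Rightarrow> ennreal" where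
  "epowr x r =
    (if r = 0 then 1
     else if x = 0 then (if r > 0 then 0 else \<infinity>)
     else if x = \<infinity> then (if r > 0 then \<infinity> else 0)
     else ennreal (enn2real x powr r))"

definition conj_exponent :: "real \<Rightarrow> real" where
  "conj_exponent p = 1 / (1 - 1 / p)"

definition cubes :: "(real ^ 'n) set set" where
  "cubes = {cbox a (a + vec l) | a l. l > (0::real)}"

(* A nonnegative locally integrable function. The value \<infinity> is permitted, but by
   local integrability only on a null set. *)
definition weight :: "(real ^ 'n \<Rightarrow> ennreal) \<Rightarrow> bool" where
  "weight w \<longleftrightarrow> w \<in> borel_measurable lebesgue \<and>
     (\<forall>K. compact K \<longrightarrow> (\<integral>\<^sup>+x\<in>K. w x \<partial>lebesgue) < \<infinity>)"

(* The maximal operator only depends on the modulus of its argument;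
   h stands for the modulus of f. *)
definition frac_maximal ::
    "real \<Rightarrow> (real ^ 'n \<Rightarrow> ennreal) \<Rightarrow> real ^ 'n \<Rightarrow> ennreal" where
  "frac_maximal \<alpha> h x =
     (SUP Q\<in>{Q \<in> cubes. x \<in> Q}.
        (\<integral>\<^sup>+y\<in>Q. h y \<partial>lebesgue) / epowr (emeasure lebesgue Q) (1 - \<alpha> / real CARD('n)))"

definition frac_maximal_mat ::
    "real \<Rightarrow> real ^ 'n ^ 'n \<Rightarrow> (real ^ 'n \<Rightarrow> ennreal) \<Rightarrow> real ^ 'n \<Rightarrow> ennreal" where
  "frac_maximal_mat \<alpha> B h x = frac_maximal \<alpha> h (B *v x)"

definition testing_const ::
    "real \<Rightarrow> real \<Rightarrow> real \<Rightarrow> (real ^ 'n \<Rightarrow> ennreal) \<Rightarrow> (real ^ 'n \<Rightarrow> ennreal) \<Rightarrow> ennreal" where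
  "testing_const \<alpha> p q u v =
     (SUP Q\<in>cubes.
        epowr (\<integral>\<^sup>+x\<in>Q. v x \<partial>lebesgue) (- (1 / p)) *
        epowr (\<integral>\<^sup>+x\<in>Q. epowr (frac_maximal \<alpha> (\<lambda>y. indicator Q y * v y) x) q * u x \<partial>lebesgue)
          (1 / q))"

definition testing_class ::
    "real \<Rightarrow> real \<Rightarrow> real \<Rightarrow> ((real ^ 'n \<Rightarrow> ennreal) \<times> (real ^ 'n \<Rightarrow> ennreal)) set" where
  "testing_class \<alpha> p q = {(u, v). weight u \<and> weight v \<and> testing_const \<alpha> p q u v < \<infinity>}"

definition mat_const ::
    "real \<Rightarrow> real ^ 'n ^ 'n \<Rightarrow> real \<Rightarrow> real \<Rightarrow> (real ^ 'n \<Rightarrow> ennreal) \<Rightarrow> ennreal" where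
  "mat_const \<alpha> A p q w =
     testing_const \<alpha> p q (\<lambda>x. epowr (w (A *v x)) q) (\<lambda>x. epowr (w x) (- conj_exponent p))"

definition mat_class ::
    "real \<Rightarrow> real ^ 'n ^ 'n \<Rightarrow> real \<Rightarrow> real \<Rightarrow> (real ^ 'n \<Rightarrow> ennreal) set" where
  "mat_class \<alpha> A p q =
     {w. ((\<lambda>x. epowr (w (A *v x)) q), (\<lambda>x. epowr (w x) (- conj_exponent p)))
           \<in> testing_class \<alpha> p q}"

(* The weighted norm inequality with constant c; below, g is the modulus of f w^(-p'),
   and the finiteness premise says that f w^(-p') is in L^p(w^p). *)
definition maximal_ineq ::
    "real \<Rightarrow> real ^ 'n ^ 'n \<Rightarrow> real \<Rightarrow> real \<Rightarrow> (real ^ 'n \<Rightarrow> ennreal) \<Rightarrow> ennreal \<Rightarrow> bool" where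
  "maximal_ineq \<alpha> A p q w c \<longleftrightarrow>
     (\<forall>f :: real ^ 'n \<Rightarrow> real. f \<in> borel_measurable lebesgue \<longrightarrow>
       (let g = (\<lambda>x. ennreal \<bar>f x\<bar> * epowr (w x) (- conj_exponent p)) in
        (\<integral>\<^sup>+x. epowr (g x) p * epowr (w x) p \<partial>lebesgue) < \<infinity> \<longrightarrow>
        epowr (\<integral>\<^sup>+x. epowr (frac_maximal_mat \<alpha> (matrix_inv A) g x) q * epowr (w x) q \<partial>lebesgue)
            (1 / q)
          \<le> c * epowr (\<integral>\<^sup>+x. epowr (g x) p * epowr (w x) p \<partial>lebesgue) (1 / p)))"

end

theory Submission
  imports Defs
begin

text \<open>
  Write \<open>\<sigma> = w\<^sup>-\<^sup>p\<^sup>'\<close> and \<open>u = w\<^sub>A\<^sup>q\<close>. A linear change of variables turns the inequality into Sawyer's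
  two-weight bound \<open>M\<^sub>\<alpha>(f\<sigma>) : L\<^sup>p(\<sigma>) \<rightarrow> L\<^sup>q(u)\<close>, up to the factor \<open>\<bar>det A\<bar>\<close>.

  For a finite family of nested cubes, group the cubes by the size \<open>2\<^sup>k < \<sigma>(Q)\<^sup>-\<^sup>1 \<integral>\<^sub>Q f\<sigma> \<le> 2\<^sup>k\<^sup>+\<^sup>1\<close> of the
  average. On a maximal cube \<open>R\<close> of the \<open>k\<close>-th group the maximal function is at most
  \<open>2\<^sup>k\<^sup>+\<^sup>1 M\<^sub>\<alpha>(\<chi>\<^sub>R\<sigma>)\<close>, so the testing condition bounds the \<open>k\<close>-th contribution by \<open>2\<^sup>k\<^sup>q\<close> times the sum of
  \<open>\<sigma>(R)\<^sup>q\<^sup>/\<^sup>p\<close>. As \<open>q \<ge> p\<close>, the sums over \<open>R\<close> and \<open>k\<close> may be moved inside the power, and the weak-type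
  estimate \<open>2\<^sup>k\<^sup>-\<^sup>1 \<sigma>(R) \<le> \<integral>\<^sub>R f \<chi>(f > 2\<^sup>k\<^sup>-\<^sup>1) \<sigma>\<close> together with a geometric series gives the norm of \<open>f\<close>. Every
  cube lies in a comparable cube of one of \<open>2\<^sup>n\<close> shifted dyadic grids, and Fatou's lemma removes
  the upper bound on the size of the cubes.

  Conversely, \<open>f = \<chi>\<^sub>Q\<close> in the inequality gives the testing condition. Before that,
  \<open>f = \<chi>(w = 0)\<close> shows that \<open>w\<close> vanishes only on a null set, and \<open>f = \<chi>\<^sub>Q \<chi>(\<sigma> \<le> k)\<close> shows that \<open>\<sigma>\<close> and
  \<open>u\<close> are locally integrable.
\<close>

section \<open>Real powers on the extended half-line\<close>

lemma epowr_zero [simp]: "r > 0 \<Longrightarrow> epowr 0 r = 0"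
  and epowr_zero_neg [simp]: "r < 0 \<Longrightarrow> epowr 0 r = top"
  and epowr_top [simp]: "r > 0 \<Longrightarrow> epowr top r = top"
  and epowr_top_neg [simp]: "r < 0 \<Longrightarrow> epowr top r = 0"
  and epowr_one [simp]: "epowr 1 r = 1"
  by (auto simp: epowr_def)

lemma epowr_ennreal: "x > 0 \<Longrightarrow> epowr (ennreal x) r = ennreal (x powr r)"
  by (auto simp: epowr_def)

lemma epowr_ennreal_nonneg: "x \<ge> 0 \<Longrightarrow> r > 0 \<Longrightarrow> epowr (ennreal x) r = ennreal (x powr r)"
  by (cases "x = 0") (auto simp: epowr_ennreal)

lemma ennreal_cases_pos [case_names zero pos top]:
  fixes x :: ennreal
  obtains "x = 0" | y where "y > 0" "x = ennreal y" | "x = top"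
  by (cases x) (auto simp: less_le)

lemma epowr_epowr: "epowr (epowr x r) s = epowr x (r * s)"
proof (cases "r = 0 \<or> s = 0")
  case True
  then show ?thesis by (auto simp: epowr_def)
next
  case False
  then consider "r > 0" "s > 0" | "r > 0" "s < 0" | "r < 0" "s > 0" | "r < 0" "s < 0" by linarith
  then show ?thesis
    by (cases; cases x rule: ennreal_cases_pos)
       (auto simp: epowr_ennreal powr_powr mult_pos_neg mult_neg_pos mult_neg_neg)
qed

lemma epowr_one_right [simp]: "epowr x 1 = x"
  by (cases x rule: ennreal_cases_pos) (auto simp: epowr_ennreal)

lemma epowr_mono: "r \<ge> 0 \<Longrightarrow> x \<le> y \<Longrightarrow> epowr x r \<le> epowr y r"
proof (cases "r = 0")
  case False
  assume "r \<ge> 0" "x \<le> y"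
  then show ?thesis using False
    by (cases x rule: ennreal_cases_pos; cases y rule: ennreal_cases_pos)
       (auto simp: epowr_ennreal powr_mono2 top_unique)
qed (simp add: epowr_def)

text \<open>Positive powers are order isomorphisms. In this form the \<open>q\<close>-th power of a
  supremum is bounded term by term, without a continuity argument for \<open>epowr\<close>.\<close>

lemma epowr_le_iff: "r > 0 \<Longrightarrow> epowr x r \<le> y \<longleftrightarrow> x \<le> epowr y (1 / r)"
  using epowr_mono[of r x "epowr y (1 / r)"] epowr_mono[of "1 / r" "epowr x r" y]
  by (auto simp: epowr_epowr)

lemma epowr_mult: "r > 0 \<Longrightarrow> epowr (x * y) r = epowr x r * epowr y r"
  by (cases x rule: ennreal_cases_pos; cases y rule: ennreal_cases_pos)
     (auto simp: epowr_ennreal powr_mult ennreal_mult_top ennreal_top_mult simp flip: ennreal_mult)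

text \<open>At 0 and \<infinity> the law breaks down because 0 * \<infinity> = 0: for
  \<open>r = 1\<close> and \<open>s = - 1\<close> the left side is 1 and the right side is
  0.\<close>

lemma epowr_add: "x \<noteq> 0 \<Longrightarrow> x \<noteq> top \<Longrightarrow> epowr x (r + s) = epowr x r * epowr x s"
  by (cases x rule: ennreal_cases_pos) (auto simp: epowr_ennreal powr_add simp flip: ennreal_mult)

lemma epowr_uminus_mult_cancel: "x \<noteq> 0 \<Longrightarrow> x \<noteq> top \<Longrightarrow> epowr x (- r) * epowr x r = 1"
  using epowr_add[of x "-r" r] by (simp add: epowr_def)

lemma epowr_eq_0_iff: "r > 0 \<Longrightarrow> epowr x r = 0 \<longleftrightarrow> x = 0"
  by (cases x rule: ennreal_cases_pos) (auto simp: epowr_ennreal)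

lemma epowr_eq_top_iff: "r > 0 \<Longrightarrow> epowr x r = top \<longleftrightarrow> x = top"
  by (cases x rule: ennreal_cases_pos) (auto simp: epowr_ennreal)

lemma measurable_epowr [measurable]:
  assumes [measurable]: "f \<in> borel_measurable M"
  shows "(\<lambda>x. epowr (f x) r) \<in> borel_measurable M"
proof -
  have 0: "Measurable.pred M (\<lambda>x. f x = c)" for c
    using measurable_sets[OF assms, of "{c}"] by (simp add: pred_def vimage_def Int_def conj_commute)
  have 1: "(\<lambda>x. ennreal (enn2real (f x) powr r)) \<in> borel_measurable M"
    by measurable
  show ?thesis
    unfolding epowr_def by (intro measurable_If 0 1) auto
qed

text \<open>With S the full sum, each term is x_i * x_i^(r-1) \<le> x_i * S^(r-1), and summing over
  i gives S^r. It is applied with \<open>r = q / p\<close>, which is why \<open>p \<le> q\<close>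
  matters.\<close>

lemma sum_epowr_le:
  assumes "finite I" "r \<ge> 1"
  shows "(\<Sum>i\<in>I. epowr (x i) r) \<le> epowr (\<Sum>i\<in>I. x i) r"
proof -
  define S where "S = (\<Sum>i\<in>I. x i)"
  consider "S = 0" | "S = top" | "S \<noteq> 0" "S \<noteq> top" by blast
  then have "(\<Sum>i\<in>I. epowr (x i) r) \<le> epowr S r"
  proof cases
    case 1
    then have "x i = 0" if "i \<in> I" for i
      using that assms(1) unfolding S_def by simp
    then show ?thesis using assms(2) by simp
  next
    case 2
    then show ?thesis using assms(2) by simp
  next
    case 3
    have le: "x i \<le> S" if "i \<in> I" for i
      unfolding S_def using that assms by (simp add: member_le_sum)
    have *: "epowr y r = y * epowr y (r - 1)" if "y \<noteq> top" for y
      using that assms epowr_add[of y 1 "r - 1"] by (cases "y = 0") auto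
    have "(\<Sum>i\<in>I. epowr (x i) r) \<le> (\<Sum>i\<in>I. x i * epowr S (r - 1))"
    proof (rule sum_mono)
      fix i assume "i \<in> I"
      then have "x i \<noteq> top" using le[of i] 3 by (auto simp: top_unique)
      then show "epowr (x i) r \<le> x i * epowr S (r - 1)"
        using *[of "x i"] le[OF \<open>i \<in> I\<close>] assms(2) by (auto intro!: mult_left_mono epowr_mono)
    qed
    also have "\<dots> = S * epowr S (r - 1)" by (simp add: S_def sum_distrib_right)
    also have "\<dots> = epowr S r" using *[of S] 3 by simp
    finally show ?thesis .
  qed
  then show ?thesis by (simp add: S_def)
qed

section \<open>Sawyer's theorem for nested families\<close>

text \<open>The condition 2^(k-1) < y caps \<open>k\<close> at \<open>m\<close>, so a geometric
  series with ratio 2^(-s) descending from \<open>m\<close> dominates the sum. The 2 in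
  \<open>2 * y\<close> pays for rounding log_2 y up to \<open>m\<close>.\<close>

lemma sum_powr_int_le:
  fixes y s :: real
  assumes "finite K" "y > 0" "s > 0"
  shows "(\<Sum>k\<in>{k\<in>K. 2 powr (of_int k - 1) < y}. 2 powr (s * of_int k)) \<le> (2 * y) powr s / (1 - 2 powr (- s))"
proof -
  define m where "m = \<lceil>log 2 y\<rceil>"
  define z :: real where "z = 2 powr (- s)"
  have z: "0 < z" "z < 1" using assms powr_less_mono[of "-s" 0 2] by (auto simp: z_def)
  let ?K = "{k\<in>K. 2 powr (of_int k - 1) < y}"
  have km: "k \<le> m" if "k \<in> ?K" for k
  proof -
    have "of_int k - 1 < log 2 y" using that assms by (simp add: less_log_iff)
    also have "\<dots> \<le> of_int m" by (simp add: m_def)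
    finally show ?thesis by linarith
  qed
  have "(\<Sum>k\<in>?K. 2 powr (s * of_int k)) = (\<Sum>k\<in>?K. 2 powr (s * of_int m) * z ^ nat (m - k))"
  proof (rule sum.cong[OF refl])
    fix k assume k: "k \<in> ?K"
    have "z ^ nat (m - k) = 2 powr (- s * (of_int m - of_int k))"
      using km[OF k] by (simp add: z_def powr_powr of_nat_nat flip: powr_realpow)
    then show "2 powr (s * of_int k) = 2 powr (s * of_int m) * z ^ nat (m - k)"
      by (simp add: algebra_simps flip: powr_add)
  qed
  also have "\<dots> = 2 powr (s * of_int m) * (\<Sum>j\<in>(\<lambda>k. nat (m - k)) ` ?K. z ^ j)"
    using km by (subst sum.reindex) (auto simp: inj_on_def sum_distrib_left eq_nat_nat_iff)
  also have "\<dots> \<le> 2 powr (s * of_int m) * (\<Sum>j. z ^ j)"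
    using z assms(1) by (intro mult_left_mono sum_le_suminf summable_geometric) auto
  also have "\<dots> = 2 powr (s * of_int m) / (1 - z)"
    using z by (simp add: suminf_geometric)
  also have "2 powr (s * of_int m) \<le> 2 powr (s * (1 + log 2 y))"
    using assms by (simp add: m_def) linarith
  also have "\<dots> = (2 * y) powr s"
    using assms by (simp add: powr_mult powr_powr distrib_left powr_add mult.commute[of s] flip: powr_powr)
  finally show ?thesis using z by (simp add: z_def divide_right_mono)
qed

text \<open>The part of \<open>R\<close> where \<open>f \<le> t\<close> contributes at most
  \<open>t\<close> times the measure of \<open>R\<close>, half of the assumed lower bound.
  Cancelling it is legitimate because the measure is finite.\<close>

lemma weak_type_half_level:
  fixes f :: "'a \<Rightarrow> real" and t :: real
  assumes [measurable]: "f \<in> borel_measurable M" "R \<in> sets M"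
    and f: "\<And>x. f x \<ge> 0" and R: "emeasure M R \<noteq> top" and t: "t > 0"
    and le: "ennreal (2 * t) * emeasure M R \<le> (\<integral>\<^sup>+x. ennreal (f x) * indicator R x \<partial>M)"
  shows "ennreal t * emeasure M R \<le> (\<integral>\<^sup>+x. ennreal (f x) * indicator {x. t < f x} x * indicator R x \<partial>M)"
    (is "_ \<le> ?J")
proof -
  have "ennreal t * emeasure M R + ennreal t * emeasure M R = ennreal (2 * t) * emeasure M R"
    using t by (simp add: ennreal_plus[symmetric] del: ennreal_plus flip: distrib_right)
  also note le
  also have "(\<integral>\<^sup>+x. ennreal (f x) * indicator R x \<partial>M) \<le>
      (\<integral>\<^sup>+x. ennreal (f x) * indicator {x. t < f x} x * indicator R x + ennreal t * indicator R x \<partial>M)"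
    by (intro nn_integral_mono) (auto split: split_indicator simp: ennreal_leI not_less)
  also have "\<dots> = ?J + ennreal t * emeasure M R"
    by (subst nn_integral_add) (auto simp: nn_integral_cmult_indicator)
  finally show ?thesis
    using R by (simp add: ennreal_mult_eq_top_iff add.commute ennreal_add_left_cancel_le)
qed

text \<open>The factor 2^q comes from the upper end 2^(k+1) of the k-th range of averages; the
  bracket is the bound of the geometric series over the levels, raised to the power
  \<open>q / p\<close>.\<close>

definition sawyer_const :: "real \<Rightarrow> real \<Rightarrow> real" where
  "sawyer_const p q = 2 powr q * (2 powr p / (1 - 2 powr (1 - p))) powr (q / p)"

text \<open>In the application \<open>M\<close> and \<open>N\<close> are the measures with densities
  \<sigma> and u, and \<open>c Q\<close> is the power of the Lebesgue measure of \<open>Q\<close> in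
  the maximal operator. Only nestedness of the sets is used; finiteness of \<open>F\<close> supplies
  maximal cubes.\<close>

lemma sawyer_finite_family:
  fixes f :: "'a \<Rightarrow> real" and c :: "'a set \<Rightarrow> ennreal" and T :: ennreal
  assumes F: "finite F" "F \<subseteq> sets M" and N: "sets N = sets M"
    and nested: "\<And>P Q. P \<in> F \<Longrightarrow> Q \<in> F \<Longrightarrow> P \<subseteq> Q \<or> Q \<subseteq> P \<or> P \<inter> Q = {}"
    and fin: "\<And>Q. Q \<in> F \<Longrightarrow> emeasure M Q \<noteq> top"
    and f [measurable]: "f \<in> borel_measurable M" and f0: "\<And>x. f x \<ge> 0"
    and pq: "1 < p" "p \<le> q"
    and I: "(\<integral>\<^sup>+x. ennreal (f x powr p) \<partial>M) \<noteq> top"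
    and testing: "\<And>R. R \<in> F \<Longrightarrow>
      (\<integral>\<^sup>+x. indicator R x * epowr (SUP Q\<in>{Q\<in>F. Q \<subseteq> R}. c Q * emeasure M Q * indicator Q x) q \<partial>N)
        \<le> T * epowr (emeasure M R) (q / p)"
  shows "(\<integral>\<^sup>+x. epowr (SUP Q\<in>F. c Q * (\<integral>\<^sup>+y. ennreal (f y) * indicator Q y \<partial>M) * indicator Q x) q \<partial>N)
    \<le> ennreal (sawyer_const p q) * T * epowr (\<integral>\<^sup>+x. ennreal (f x powr p) \<partial>M) (q / p)"
proof -
  define E where "E Q = (\<integral>\<^sup>+y. ennreal (f y) * indicator Q y \<partial>M)" for Q
  \<comment> \<open>Sets with zero integral contribute nothing to the supremum and have no
    logarithmic level.\<close>
  define F' where "F' = {Q\<in>F. E Q \<noteq> 0}"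
  \<comment> \<open>Ceiling minus one places the average in the range from 2^\<kappa> (exclusive) to
    2^(\<kappa>+1) (inclusive).\<close>
  define \<kappa> where "\<kappa> Q = \<lceil>log 2 (enn2real (E Q) / measure M Q)\<rceil> - 1" for Q
  define Mx where "Mx k = {R\<in>F'. \<kappa> R = k \<and> (\<forall>Q\<in>F'. \<kappa> Q = k \<longrightarrow> R \<subseteq> Q \<longrightarrow> Q = R)}" for k
  \<comment> \<open>The function that the testing condition on \<open>R\<close> controls.\<close>
  define H where "H R x = (indicator R x :: ennreal) * epowr (SUP Q\<in>{Q\<in>F. Q \<subseteq> R}. c Q * emeasure M Q * indicator Q x) q"
    for R x
  define e where "e k = (2::real) powr of_int k" for k
  define K where "K = \<kappa> ` F'"
  define S where "S k = (\<Sum>R\<in>Mx k. emeasure M R)" for k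
  define I where "I = (\<integral>\<^sup>+x. ennreal (f x powr p) \<partial>M)"
  have q: "q > 1" "q > 0" "q / p \<ge> 1" "q / p > 0" using pq by auto
  have [measurable]: "Q \<in> sets M" "Q \<in> sets N" if "Q \<in> F" for Q using that F N by auto
  have finF': "finite F'" "finite K" and finMx: "finite (Mx k)" for k
    using F by (auto simp: F'_def K_def Mx_def)
  have F'F: "F' \<subseteq> F" and MxF': "Mx k \<subseteq> F'" for k by (auto simp: F'_def Mx_def)
  have e_pos: "e k > 0" for k by (simp add: e_def)
  \<comment> \<open>As \<open>p > 1\<close>, this makes \<open>f\<close> integrable over every set
    of finite measure, so that the averages are finite.\<close>
  have fp: "f x \<le> 1 + f x powr p" for x
  proof (cases "f x \<le> 1")
    case False
    then have "f x powr 1 \<le> f x powr p" using pq by (intro powr_mono) auto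
    then show ?thesis using False by simp
  qed (use f0[of x] powr_ge_zero[of "f x" p] in linarith)
  have avg: "ennreal (e (\<kappa> Q)) * emeasure M Q \<le> E Q"
      "E Q \<le> ennreal (2 * e (\<kappa> Q)) * emeasure M Q" if "Q \<in> F'" for Q
  proof -
    have Q [measurable]: "Q \<in> sets M" and Qfin: "emeasure M Q \<noteq> top" using that F fin by (auto simp: F'_def)
    have "E Q \<le> (\<integral>\<^sup>+y. ennreal (f y powr p) + indicator Q y \<partial>M)"
      unfolding E_def
    proof (rule nn_integral_mono)
      fix y
      have "ennreal (f y) \<le> ennreal (f y powr p) + 1"
        using ennreal_leI[OF fp[of y]] by (simp add: add.commute)
      then show "ennreal (f y) * indicator Q y \<le> ennreal (f y powr p) + indicator Q y"
        by (auto split: split_indicator)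
    qed
    also have "\<dots> = (\<integral>\<^sup>+y. ennreal (f y powr p) \<partial>M) + emeasure M Q"
      by (subst nn_integral_add) auto
    finally have Efin: "E Q \<noteq> top" using assms(10) Qfin by (auto simp: top_unique)
    have E0: "E Q \<noteq> 0" using that by (simp add: F'_def)
    \<comment> \<open>The average needs a nonzero denominator: a null set would have integral zero
      and would not lie in \<open>F'\<close>.\<close>
    have M0: "emeasure M Q \<noteq> 0"
    proof
      assume "emeasure M Q = 0"
      then have "AE x in M. x \<notin> Q" by (intro AE_not_in) (auto simp: null_sets_def)
      then have "E Q = 0" unfolding E_def by (subst nn_integral_0_iff_AE) (auto elim!: eventually_mono)
      with E0 show False by simp
    qed
    obtain a where a: "a > 0" "E Q = ennreal a" using E0 Efin by (metis ennreal_cases_pos)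
    obtain b where b: "b > 0" "emeasure M Q = ennreal b" using M0 Qfin by (metis ennreal_cases_pos)
    have m: "measure M Q = b" using b by (simp add: measure_def)
    have k: "of_int (\<kappa> Q) \<le> log 2 (a / b)" "log 2 (a / b) \<le> of_int (\<kappa> Q) + 1"
      using a m by (auto simp: \<kappa>_def)
    have "e (\<kappa> Q) \<le> a / b" using k(1) a b by (simp add: e_def le_log_iff)
    then show "ennreal (e (\<kappa> Q)) * emeasure M Q \<le> E Q"
      using a b by (simp add: field_simps ennreal_leI e_pos less_imp_le flip: ennreal_mult)
    have "a / b \<le> 2 * e (\<kappa> Q)" using k(2) a b by (simp add: e_def log_le_iff powr_add)
    then show "E Q \<le> ennreal (2 * e (\<kappa> Q)) * emeasure M Q"
      using a b e_pos by (simp add: field_simps ennreal_leI less_imp_le flip: ennreal_mult)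
  qed
  \<comment> \<open>Two distinct maximal sets of one level cannot contain each other, so nestedness
    leaves only disjointness.\<close>
  have disj: "R \<inter> R' = {}" if "R \<in> Mx k" "R' \<in> Mx k" "R \<noteq> R'" for k R R'
    using that nested[of R R'] by (auto simp: Mx_def F'_def)
  \<comment> \<open>For a given \<open>Q\<close>, a single summand on the right suffices: the level
    of \<open>Q\<close> and a maximal set of that level containing \<open>Q\<close>.\<close>
  have pointwise: "epowr (SUP Q\<in>F. c Q * E Q * indicator Q x) q \<le>
      (\<Sum>k\<in>K. ennreal ((2 * e k) powr q) * (\<Sum>R\<in>Mx k. H R x))" (is "_ \<le> ?B") for x
    unfolding epowr_le_iff[OF q(2)]
  proof (rule SUP_least)
    fix Q assume Q: "Q \<in> F"
    show "c Q * E Q * indicator Q x \<le> epowr ?B (1 / q)"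
    proof (cases "Q \<in> F' \<and> x \<in> Q")
      case False
      then show ?thesis using Q by (auto simp: F'_def)
    next
      case True
      then have "finite {P\<in>F'. \<kappa> P = \<kappa> Q}" "Q \<in> {P\<in>F'. \<kappa> P = \<kappa> Q}" using finF' by auto
      from finite_has_maximal2[OF this] obtain R where R: "R \<in> F'" "\<kappa> R = \<kappa> Q" "Q \<subseteq> R"
        "\<And>P. P \<in> F' \<Longrightarrow> \<kappa> P = \<kappa> Q \<Longrightarrow> R \<subseteq> P \<Longrightarrow> R = P" by (auto simp: mem_Collect_eq)
      then have RM: "R \<in> Mx (\<kappa> Q)" by (auto simp: Mx_def)
      have "c Q * E Q * indicator Q x \<le> c Q * (ennreal (2 * e (\<kappa> Q)) * emeasure M Q) * indicator Q x"
        using avg(2)[of Q] True by (intro mult_right_mono mult_left_mono) auto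
      also have "\<dots> = ennreal (2 * e (\<kappa> Q)) * (c Q * emeasure M Q * indicator Q x)" by (simp add: ac_simps)
      also have "\<dots> \<le> ennreal (2 * e (\<kappa> Q)) * (SUP Q\<in>{Q\<in>F. Q \<subseteq> R}. c Q * emeasure M Q * indicator Q x)"
        using Q R by (intro mult_left_mono SUP_upper) auto
      finally have "epowr (c Q * E Q * indicator Q x) q \<le> ennreal ((2 * e (\<kappa> Q)) powr q) * H R x"
        using True R(3) q e_pos[of "\<kappa> Q"] epowr_mono[of q]
        by (fastforce simp: H_def epowr_mult epowr_ennreal)
      also have "\<dots> \<le> ennreal ((2 * e (\<kappa> Q)) powr q) * (\<Sum>R\<in>Mx (\<kappa> Q). H R x)"
        using RM finMx by (intro mult_left_mono member_le_sum) auto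
      also have "\<dots> \<le> ?B"
        using True finF' by (intro member_le_sum) (auto simp: K_def)
      finally show ?thesis by (simp add: epowr_le_iff[OF q(2)])
    qed
  qed
  have Hm [measurable]: "H R \<in> borel_measurable N" if "R \<in> F'" for R
    using that F'F F unfolding H_def[abs_def]
    by (intro borel_measurable_times_ennreal measurable_epowr borel_measurable_SUP borel_measurable_indicator
        borel_measurable_const) (auto intro: countable_finite simp: N)
  have "(\<integral>\<^sup>+x. epowr (SUP Q\<in>F. c Q * E Q * indicator Q x) q \<partial>N) \<le>
      (\<integral>\<^sup>+x. (\<Sum>k\<in>K. ennreal ((2 * e k) powr q) * (\<Sum>R\<in>Mx k. H R x)) \<partial>N)"
    by (intro nn_integral_mono pointwise)
  also have "\<dots> = (\<Sum>k\<in>K. ennreal ((2 * e k) powr q) * (\<Sum>R\<in>Mx k. \<integral>\<^sup>+x. H R x \<partial>N))"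
    using MxF' by (subst nn_integral_sum | subst nn_integral_cmult | rule sum.cong refl arg_cong2[where f="(*)"] | 
      intro borel_measurable_sum borel_measurable_times_ennreal borel_measurable_const Hm | blast)+
  also have "\<dots> \<le> (\<Sum>k\<in>K. ennreal ((2 * e k) powr q) * (\<Sum>R\<in>Mx k. T * epowr (emeasure M R) (q / p)))"
    using MxF' F'F testing unfolding H_def by (intro sum_mono mult_left_mono zero_le) blast
  \<comment> \<open>Superadditivity of the power \<open>q / p\<close> merges the maximal sets of one
    level; it is used once more below to merge the levels.\<close>
  also have "\<dots> \<le> (\<Sum>k\<in>K. ennreal ((2 * e k) powr q) * (T * epowr (S k) (q / p)))"
    unfolding S_def using finMx q
    by (intro sum_mono mult_left_mono) (auto simp flip: sum_distrib_left intro!: mult_left_mono sum_epowr_le)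
  also have "\<dots> = (\<Sum>k\<in>K. ennreal (2 powr q) * T * epowr (ennreal (e k powr p) * S k) (q / p))"
  proof (rule sum.cong[OF refl])
    fix k
    have "(2 * e k) powr q = 2 powr q * (e k powr p) powr (q / p)"
      using pq e_pos[of k] by (simp add: powr_mult powr_powr)
    then show "ennreal ((2 * e k) powr q) * (T * epowr (S k) (q / p)) =
        ennreal (2 powr q) * T * epowr (ennreal (e k powr p) * S k) (q / p)"
      using q e_pos[of k] by (simp add: epowr_mult epowr_ennreal ennreal_mult ac_simps)
  qed
  also have "\<dots> \<le> ennreal (2 powr q) * T * epowr (\<Sum>k\<in>K. ennreal (e k powr p) * S k) (q / p)"
    using finF' q by (auto simp flip: sum_distrib_left intro!: mult_left_mono sum_epowr_le)
  finally have main: "(\<integral>\<^sup>+x. epowr (SUP Q\<in>F. c Q * E Q * indicator Q x) q \<partial>N) \<le>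
    ennreal (2 powr q) * T * epowr (\<Sum>k\<in>K. ennreal (e k powr p) * S k) (q / p)" .
  \<comment> \<open>The factor 2^(kp) is split as (2 * 2^(k(p-1))) * 2^(k-1). The last factor is
    absorbed by the weak-type estimate; after exchanging sum and integral, the first is summed over
    the levels with 2^(k-1) < f(x).\<close>
  have levels: "(\<Sum>k\<in>K. ennreal (e k powr p) * S k) \<le> ennreal (2 powr p / (1 - 2 powr (1 - p))) * I"
  proof -
    have weak: "ennreal (e k / 2) * S k \<le> (\<integral>\<^sup>+x. ennreal (f x) * indicator {x. e k / 2 < f x} x \<partial>M)" for k
    proof -
      have "ennreal (e k / 2) * S k = (\<Sum>R\<in>Mx k. ennreal (e k / 2) * emeasure M R)"
        by (simp add: S_def sum_distrib_left)
      also have "\<dots> \<le> (\<Sum>R\<in>Mx k. \<integral>\<^sup>+x. ennreal (f x) * indicator {x. e k / 2 < f x} x * indicator R x \<partial>M)"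
        using avg(1) F'F fin F e_pos[of k]
        by (intro sum_mono weak_type_half_level f0 f) (auto simp: E_def Mx_def)
      also have "\<dots> = (\<integral>\<^sup>+x. (\<Sum>R\<in>Mx k. ennreal (f x) * indicator {x. e k / 2 < f x} x * indicator R x) \<partial>M)"
        proof (rule nn_integral_sum[symmetric])
        fix R assume "R \<in> Mx k"
        then have [measurable]: "R \<in> sets M" using MxF' F'F F(2) by blast
        show "(\<lambda>x. ennreal (f x) * indicator {x. e k / 2 < f x} x * indicator R x) \<in> borel_measurable M"
          by measurable
      qed
      also have "\<dots> \<le> (\<integral>\<^sup>+x. ennreal (f x) * indicator {x. e k / 2 < f x} x \<partial>M)"
      proof (rule nn_integral_mono)
        fix x
        \<comment> \<open>By disjointness at most one indicator is nonzero at \<open>x\<close>, so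
          the local integrals add up to at most the global one.\<close>
        have "(\<Sum>R\<in>Mx k. indicator R x :: ennreal) = indicator (\<Union>R\<in>Mx k. R) x"
          by (rule indicator_UN_disjoint[symmetric]) (use finMx disj in \<open>auto simp: disjoint_family_on_def\<close>)
        also have "\<dots> \<le> 1" by (simp add: indicator_def)
        finally have "ennreal (f x) * indicator {x. e k / 2 < f x} x * (\<Sum>R\<in>Mx k. indicator R x)
            \<le> ennreal (f x) * indicator {x. e k / 2 < f x} x * 1" by (rule mult_left_mono) simp
        then show "(\<Sum>R\<in>Mx k. ennreal (f x) * indicator {x. e k / 2 < f x} x * indicator R x)
            \<le> ennreal (f x) * indicator {x. e k / 2 < f x} x" by (simp add: sum_distrib_left)
      qed
      finally show ?thesis .
    qed
    have "(\<Sum>k\<in>K. ennreal (e k powr p) * S k) = (\<Sum>k\<in>K. ennreal (2 * e k powr (p - 1)) * (ennreal (e k / 2) * S k))"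
    proof (rule sum.cong[OF refl])
      fix k
      have "e k powr p = 2 * e k powr (p - 1) * (e k / 2)"
        using e_pos[of k] by (simp add: powr_diff)
      then show "ennreal (e k powr p) * S k = ennreal (2 * e k powr (p - 1)) * (ennreal (e k / 2) * S k)"
        using e_pos[of k] by (simp only: mult.assoc[symmetric] ennreal_mult'[symmetric]) (simp flip: ennreal_mult'' ennreal_mult)
    qed
    also have "\<dots> \<le> (\<Sum>k\<in>K. ennreal (2 * e k powr (p - 1)) * (\<integral>\<^sup>+x. ennreal (f x) * indicator {x. e k / 2 < f x} x \<partial>M))"
      by (intro sum_mono mult_left_mono weak) simp
    also have "\<dots> = (\<integral>\<^sup>+x. (\<Sum>k\<in>K. ennreal (2 * e k powr (p - 1)) * (ennreal (f x) * indicator {x. e k / 2 < f x} x)) \<partial>M)"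
      by (subst nn_integral_sum) (auto simp: nn_integral_cmult)
    also have "\<dots> \<le> (\<integral>\<^sup>+x. ennreal (2 powr p / (1 - 2 powr (1 - p))) * ennreal (f x powr p) \<partial>M)"
    proof (rule nn_integral_mono)
      fix x
      show "(\<Sum>k\<in>K. ennreal (2 * e k powr (p - 1)) * (ennreal (f x) * indicator {x. e k / 2 < f x} x))
        \<le> ennreal (2 powr p / (1 - 2 powr (1 - p))) * ennreal (f x powr p)"
      proof (cases "f x = 0")
        case False
        then have fx: "f x > 0" using f0[of x] by simp
        have e1: "e k powr (p - 1) = 2 powr ((p - 1) * of_int k)" and e2: "e k / 2 = 2 powr (of_int k - 1)" for k
          by (simp_all add: e_def powr_powr powr_diff[of 2 _ 1] mult.commute)
        have "(\<Sum>k\<in>K. ennreal (2 * e k powr (p - 1)) * (ennreal (f x) * indicator {x. e k / 2 < f x} x))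
           = (\<Sum>k\<in>K. if 2 powr (of_int k - 1) < f x then ennreal (2 * f x * 2 powr ((p - 1) * of_int k)) else 0)"
          using fx unfolding e1 e2 by (intro sum.cong refl) (auto simp: ac_simps simp flip: ennreal_mult)
        also have "\<dots> = (\<Sum>k\<in>{k\<in>K. 2 powr (of_int k - 1) < f x}. ennreal (2 * f x * 2 powr ((p - 1) * of_int k)))"
          using finF' by (simp add: sum.inter_filter)
        also have "\<dots> = ennreal (2 * f x * (\<Sum>k\<in>{k\<in>K. 2 powr (of_int k - 1) < f x}. 2 powr ((p - 1) * of_int k)))"
          using fx by (simp add: sum_ennreal sum_distrib_left)
        \<comment> \<open>The geometric series with exponent \<open>s = p - 1\<close>, positive
          because \<open>p > 1\<close>.\<close>
        also have "\<dots> \<le> ennreal (2 * f x * ((2 * f x) powr (p - 1) / (1 - 2 powr (- (p - 1)))))"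
          using fx pq finF' by (intro ennreal_leI mult_left_mono sum_powr_int_le) auto
        also have "2 * f x * ((2 * f x) powr (p - 1) / (1 - 2 powr (- (p - 1)))) =
            2 powr p / (1 - 2 powr (1 - p)) * f x powr p"
          using fx by (simp add: powr_diff powr_mult)
        finally show ?thesis by (simp only: ennreal_mult''[OF powr_ge_zero])
      qed simp
    qed
    also have "\<dots> = ennreal (2 powr p / (1 - 2 powr (1 - p))) * I"
      unfolding I_def by (rule nn_integral_cmult) measurable
    finally show ?thesis .
  qed
  note main
  also have "ennreal (2 powr q) * T * epowr (\<Sum>k\<in>K. ennreal (e k powr p) * S k) (q / p) \<le>
     ennreal (2 powr q) * T * epowr (ennreal (2 powr p / (1 - 2 powr (1 - p))) * I) (q / p)"
    using q by (intro mult_left_mono epowr_mono levels) auto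
  also have "epowr (ennreal (2 powr p / (1 - 2 powr (1 - p))) * I) (q / p) =
      ennreal ((2 powr p / (1 - 2 powr (1 - p))) powr (q / p)) * epowr I (q / p)"
    using q pq powr_less_mono[of "1 - p" 0 2] by (simp only: epowr_mult, subst epowr_ennreal) auto
  also have "ennreal (2 powr q) * T * \<dots> = ennreal (sawyer_const p q) * T * epowr I (q / p)"
    by (simp add: sawyer_const_def ennreal_mult ac_simps)
  finally show ?thesis by (simp add: E_def I_def)
qed

text \<open>An enumeration exhausts \<open>D\<close> by finite subfamilies. They inherit the testing
  bound, since their suprema are smaller, and the constant does not depend on the subfamily, so
  monotone convergence applies.\<close>

lemma sawyer_countable_family:
  fixes f :: "'a \<Rightarrow> real" and c :: "'a set \<Rightarrow> ennreal" and T :: ennreal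
  assumes D: "countable D" "D \<subseteq> sets M" and N: "sets N = sets M"
    and nested: "\<And>P Q. P \<in> D \<Longrightarrow> Q \<in> D \<Longrightarrow> P \<subseteq> Q \<or> Q \<subseteq> P \<or> P \<inter> Q = {}"
    and fin: "\<And>Q. Q \<in> D \<Longrightarrow> emeasure M Q \<noteq> top"
    and f [measurable]: "f \<in> borel_measurable M" and f0: "\<And>x. f x \<ge> 0"
    and pq: "1 < p" "p \<le> q"
    and I: "(\<integral>\<^sup>+x. ennreal (f x powr p) \<partial>M) \<noteq> top"
    and testing: "\<And>R. R \<in> D \<Longrightarrow>
      (\<integral>\<^sup>+x. indicator R x * epowr (SUP Q\<in>{Q\<in>D. Q \<subseteq> R}. c Q * emeasure M Q * indicator Q x) q \<partial>N)
        \<le> T * epowr (emeasure M R) (q / p)"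
  shows "(\<integral>\<^sup>+x. epowr (SUP Q\<in>D. c Q * (\<integral>\<^sup>+y. ennreal (f y) * indicator Q y \<partial>M) * indicator Q x) q \<partial>N)
    \<le> ennreal (sawyer_const p q) * T * epowr (\<integral>\<^sup>+x. ennreal (f x powr p) \<partial>M) (q / p)"
    (is "_ \<le> ?B")
proof (cases "D = {}")
  case True
  then show ?thesis using pq by (simp add: bot_ennreal)
next
  case False
  define X where "X Q x = c Q * (\<integral>\<^sup>+y. ennreal (f y) * indicator Q y \<partial>M) * indicator Q x" for Q x
  define F where "F n = from_nat_into D ` {..n}" for n :: nat
  have FD: "F n \<subseteq> D" for n using from_nat_into[OF False] by (auto simp: F_def)
  have FN: "F n \<subseteq> sets N" for n using FD D N by blast
  have fin_bound: "(\<integral>\<^sup>+x. epowr (SUP Q\<in>F n. X Q x) q \<partial>N) \<le> ?B" for n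
    unfolding X_def
  proof (rule sawyer_finite_family[OF _ _ N _ _ f f0 pq I])
    show "finite (F n)" by (simp add: F_def)
    show "F n \<subseteq> sets M" using FD D by blast
    show "P \<subseteq> Q \<or> Q \<subseteq> P \<or> P \<inter> Q = {}" if "P \<in> F n" "Q \<in> F n" for P Q
      using nested[of P Q] that FD by blast
    show "emeasure M Q \<noteq> top" if "Q \<in> F n" for Q using fin that FD by blast
    show "(\<integral>\<^sup>+x. indicator R x * epowr (SUP Q\<in>{Q\<in>F n. Q \<subseteq> R}. c Q * emeasure M Q * indicator Q x) q \<partial>N)
        \<le> T * epowr (emeasure M R) (q / p)" if "R \<in> F n" for R
    proof -
      have "(SUP Q\<in>{Q\<in>F n. Q \<subseteq> R}. c Q * emeasure M Q * indicator Q x) \<le>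
        (SUP Q\<in>{Q\<in>D. Q \<subseteq> R}. c Q * emeasure M Q * indicator Q x)" for x
        using FD by (intro SUP_subset_mono) auto
      then have "(\<integral>\<^sup>+x. indicator R x * epowr (SUP Q\<in>{Q\<in>F n. Q \<subseteq> R}. c Q * emeasure M Q * indicator Q x) q \<partial>N)
        \<le> (\<integral>\<^sup>+x. indicator R x * epowr (SUP Q\<in>{Q\<in>D. Q \<subseteq> R}. c Q * emeasure M Q * indicator Q x) q \<partial>N)"
        using pq by (intro nn_integral_mono mult_left_mono epowr_mono) auto
      also have "\<dots> \<le> T * epowr (emeasure M R) (q / p)" using testing that FD by blast
      finally show ?thesis .
    qed
  qed
  have "(\<integral>\<^sup>+x. epowr (SUP Q\<in>D. X Q x) q \<partial>N) \<le> (\<integral>\<^sup>+x. (SUP n. epowr (SUP Q\<in>F n. X Q x) q) \<partial>N)"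
  proof (rule nn_integral_mono)
    fix x
    have q: "q > 0" using pq by simp
    show "epowr (SUP Q\<in>D. X Q x) q \<le> (SUP n. epowr (SUP Q\<in>F n. X Q x) q)"
      unfolding epowr_le_iff[OF q]
    proof (rule SUP_least)
      fix Q assume "Q \<in> D"
      then obtain n where "Q \<in> F n"
        using from_nat_into_surj[OF D(1)] unfolding F_def by blast
      then have "epowr (X Q x) q \<le> epowr (SUP Q\<in>F n. X Q x) q"
        using q by (intro epowr_mono SUP_upper) auto
      also have "\<dots> \<le> (SUP n. epowr (SUP Q\<in>F n. X Q x) q)" by (rule SUP_upper) simp
      finally show "X Q x \<le> epowr (SUP n. epowr (SUP Q\<in>F n. X Q x) q) (1 / q)"
        by (simp add: epowr_le_iff[OF q])
    qed
  qed
  also have "\<dots> = (SUP n. \<integral>\<^sup>+x. epowr (SUP Q\<in>F n. X Q x) q \<partial>N)"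
  proof (rule nn_integral_monotone_convergence_SUP)
    show "incseq (\<lambda>n x. epowr (SUP Q\<in>F n. X Q x) q)"
      using pq by (intro incseq_SucI le_funI epowr_mono SUP_subset_mono) (auto simp: F_def)
    show "(\<lambda>x. epowr (SUP Q\<in>F n. X Q x) q) \<in> borel_measurable N" for n
      unfolding X_def using FN[of n]
      by (intro measurable_epowr borel_measurable_SUP borel_measurable_times_ennreal
          borel_measurable_indicator borel_measurable_const) (auto simp: F_def)
  qed
  also have "\<dots> \<le> ?B" by (intro SUP_least fin_bound)
  finally show ?thesis by (simp add: X_def)
qed

section \<open>Shifted dyadic grids\<close>

text \<open>These are half-open cubes of side L / 2^j. Floors turn nesting into integer division,
  and a natural \<open>j\<close> keeps the side at most \<open>L\<close>.\<close>

definition grid_cube :: "real \<Rightarrow> real ^ 'n \<Rightarrow> nat \<Rightarrow> ('n \<Rightarrow> int) \<Rightarrow> (real ^ 'n) set" where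
  "grid_cube L s j m = {x. \<forall>i. \<lfloor>2 ^ j * (x $ i - s $ i) / L\<rfloor> = m i}"

definition grid :: "real \<Rightarrow> real ^ 'n \<Rightarrow> (real ^ 'n) set set" where
  "grid L s = {grid_cube L s j m | j m. True}"

lemma countable_grid: "countable (grid L (s :: real ^ 'n::finite))"
proof -
  have "grid L s = (\<lambda>(j, m). grid_cube L s j m) ` UNIV" by (auto simp: grid_def)
  then show ?thesis by simp
qed

text \<open>The floor at a coarse scale is the floor at a finer scale divided by a power of 2. The
  fine index thus determines the coarse one, and a fine cube meeting a coarse cube lies in
  it.\<close>

lemma grid_nested:
  assumes "P \<in> grid L s" "Q \<in> grid L s"
  shows "P \<subseteq> Q \<or> Q \<subseteq> P \<or> P \<inter> Q = {}"
proof -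
  have *: "grid_cube L s j' m' \<subseteq> grid_cube L s j m \<or> grid_cube L s j' m' \<inter> grid_cube L s j m = {}"
    if "j \<le> j'" for j j' m m'
  proof (rule disjCI)
    assume "grid_cube L s j' m' \<inter> grid_cube L s j m \<noteq> {}"
    then obtain z where z: "z \<in> grid_cube L s j' m'" "z \<in> grid_cube L s j m" by auto
    have coarse: "\<lfloor>2 ^ j * t / L\<rfloor> = \<lfloor>2 ^ j' * t / L\<rfloor> div 2 ^ (j' - j)" for t :: real
    proof -
      have "(2::real) ^ j' = 2 ^ j * 2 ^ (j' - j)"
        using that by (simp only: power_add[symmetric] le_add_diff_inverse)
      then have "2 ^ j * t / L = (2 ^ j' * t / L) / real_of_int (2 ^ (j' - j))"
        by (simp only: of_int_power of_int_numeral) simp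
      then show ?thesis by (simp only: floor_divide_real_eq_div zero_le_power zero_le_numeral)
    qed
    show "grid_cube L s j' m' \<subseteq> grid_cube L s j m"
      using z by (auto simp: grid_cube_def coarse)
  qed
  from assms obtain j m j' m' where "P = grid_cube L s j m" "Q = grid_cube L s j' m'"
    by (auto simp: grid_def)
  then show ?thesis using *[of j j' m' m] *[of j' j m m'] by (cases "j \<le> j'") (auto simp: Int_commute)
qed

text \<open>Squeezing the half-open cube between an open and a closed box shows that it differs from
  a closed cube only on a null boundary.\<close>

lemma grid_cube_between:
  fixes s :: "real ^ 'n::finite" and m :: "'n \<Rightarrow> int" and j :: nat
  assumes "L > 0"
  defines "a \<equiv> \<chi> i. s $ i + L / 2 ^ j * of_int (m i)"
  shows "box a (a + vec (L / 2 ^ j)) \<subseteq> grid_cube L s j m" "grid_cube L s j m \<subseteq> cbox a (a + vec (L / 2 ^ j))"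
proof -
  have *: "\<lfloor>2 ^ j * (y - t) / L\<rfloor> = k \<longleftrightarrow>
      t + L / 2 ^ j * of_int k \<le> y \<and> y < t + L / 2 ^ j * of_int k + L / 2 ^ j" for y t k
    using assms by (simp add: floor_eq_iff field_simps)
  show "box a (a + vec (L / 2 ^ j)) \<subseteq> grid_cube L s j m" "grid_cube L s j m \<subseteq> cbox a (a + vec (L / 2 ^ j))"
    by (auto simp: grid_cube_def * mem_box_cart a_def less_imp_le)
qed

lemma emeasure_cube:
  fixes a :: "real ^ 'n::finite"
  assumes "l \<ge> 0"
  shows "emeasure lebesgue (cbox a (a + vec l)) = ennreal (l ^ CARD('n))"
proof -
  have "cbox a (a + vec l) \<noteq> {}"
    using assms by (auto simp: interval_eq_empty_cart)
  then have "measure lebesgue (cbox a (a + vec l)) = l ^ CARD('n)"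
    by (simp add: content_cbox_cart)
  then show ?thesis by (metis emeasure_eq_measure2 lmeasurable_cbox)
qed

lemma
  fixes s :: "real ^ 'n::finite"
  assumes "P \<in> grid L s" "L > 0"
  shows grid_closure_cube: "\<exists>Q\<in>cubes. P \<subseteq> Q \<and> Q - P \<in> null_sets lebesgue \<and> emeasure lebesgue P = emeasure lebesgue Q"
    and grid_lebesgue: "P \<in> sets lebesgue"
proof -
  from assms obtain j m where P: "P = grid_cube L s j m" by (auto simp: grid_def)
  define a where "a = (\<chi> i. s $ i + L / 2 ^ j * of_int (m i))"
  define b where "b = a + vec (L / 2 ^ j)"
  have sub: "box a b \<subseteq> P" "P \<subseteq> cbox a b"
    using grid_cube_between[OF assms(2), where s=s and j=j and m=m] by (simp_all add: P a_def b_def)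
  have null: "cbox a b - P \<in> null_sets lebesgue"
    using negligible_subset[OF negligible_frontier_interval, of "cbox a b - P" a b] sub
    by (auto simp flip: negligible_iff_null_sets)
  have P_eq: "P = cbox a b - (cbox a b - P)" using sub by auto
  show "P \<in> sets lebesgue" by (subst P_eq) (intro sets.Diff null_setsD2[OF null], simp)
  have "emeasure lebesgue P = emeasure lebesgue (cbox a b)"
    using emeasure_Diff_null_set[OF null, of "cbox a b"] P_eq by simp
  moreover have "L / 2 ^ j > 0" using assms(2) by simp
  then have "cbox a b \<in> cubes" unfolding cubes_def b_def by blast
  ultimately show "\<exists>Q\<in>cubes. P \<subseteq> Q \<and> Q - P \<in> null_sets lebesgue \<and> emeasure lebesgue P = emeasure lebesgue Q"
    using sub null by blast
qed

text \<open>The one-third trick. If both floors jumped, integers k and k' would satisfy |k - k' -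
  2^j / 3| < 1/3, hence 3(k - k') = 2^j, although 3 does not divide a power of 2.\<close>

lemma floor_shift_dichotomy:
  fixes y h :: real
  assumes "0 \<le> h" "h \<le> 1 / 3"
  shows "\<lfloor>y + h\<rfloor> = \<lfloor>y\<rfloor> \<or> \<lfloor>y + h - 2 ^ j / 3\<rfloor> = \<lfloor>y - 2 ^ j / 3\<rfloor>"
proof (rule ccontr)
  assume "\<not> ?thesis"
  then have "\<lfloor>y\<rfloor> < \<lfloor>y + h\<rfloor>" "\<lfloor>y - 2 ^ j / 3\<rfloor> < \<lfloor>y + h - 2 ^ j / 3\<rfloor>"
    using floor_mono[of y "y + h"] floor_mono[of "y - 2 ^ j / 3" "y + h - 2 ^ j / 3"] assms(1) by auto
  then obtain k k' where k: "y < of_int k" "of_int k \<le> y + h" "y - 2 ^ j / 3 < of_int k'" "of_int k' \<le> y + h - 2 ^ j / 3"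
    by (meson floor_less_iff le_floor_iff order_refl)
  then have "\<bar>3 * real_of_int (k - k') - 2 ^ j\<bar> < 1" using assms by (simp add: abs_less_iff)
  then have "\<bar>real_of_int (3 * (k - k') - 2 ^ j)\<bar> < 1" by simp
  then have "3 * (k - k') = 2 ^ j" by linarith
  then have "(2::int) ^ j mod 3 = 0" by presburger
  moreover have "(2::int) ^ i mod 3 = 1 \<or> (2::int) ^ i mod 3 = 2" for i
  proof (induction i)
    case (Suc i)
    then show ?case unfolding power_Suc by presburger
  qed simp
  ultimately show False by (metis zero_neq_one zero_neq_numeral)
qed

text \<open>
  Translating by \<open>L / 3\<close> moves the grid of mesh \<open>L / 2\<^sup>j\<close> by \<open>1/3\<close> or \<open>2/3\<close> of its mesh for every \<open>j\<close>, so one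
  shift per coordinate serves all scales.
\<close>

definition grid_shift :: "real \<Rightarrow> 'n set \<Rightarrow> real ^ 'n" where
  "grid_shift L T = (\<chi> i. if i \<in> T then L / 3 else 0)"

text \<open>At a mesh between 3l and 6l, the side \<open>l\<close> is at most a third of the mesh.
  In each coordinate either the unshifted or the shifted grid then leaves the side uncut.\<close>

lemma cube_in_grid:
  fixes a :: "real ^ 'n::finite"
  assumes "l > 0" "3 * l \<le> L"
  obtains T P where "P \<in> grid L (grid_shift L T)" "cbox a (a + vec l) \<subseteq> P"
    "emeasure lebesgue P \<le> ennreal ((6 * l) ^ CARD('n))"
proof -
  have L: "L > 0" using assms by linarith
  obtain j where j: "3 * l \<le> L / 2 ^ j" "L / 2 ^ j \<le> 6 * l"
  proof -
    have ex: "\<exists>j. L / 2 ^ j < 6 * l"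
    proof -
      obtain j :: nat where "L / (6 * l) < 2 ^ j" using real_arch_pow[of 2] by auto
      then show ?thesis using assms by (auto simp: field_simps)
    qed
    \<comment> \<open>The first scale below 6l. The preceding one is at least 6l, so this one is at
      least 3l; at \<open>j = 0\<close> the hypothesis \<open>3 * l \<le> L\<close> replaces the
      preceding scale.\<close>
    define j where "j = (LEAST j. L / 2 ^ j < 6 * l)"
    have 1: "L / 2 ^ j < 6 * l" unfolding j_def using ex by (rule LeastI_ex)
    have "3 * l \<le> L / 2 ^ j"
    proof (cases j)
      case (Suc i)
      then have "\<not> L / 2 ^ i < 6 * l" using not_less_Least[of i "\<lambda>j. L / 2 ^ j < 6 * l", folded j_def] by simp
      then show ?thesis by (simp add: Suc field_simps)
    qed (use assms in simp)
    with 1 show ?thesis using that[of j] by simp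
  qed
  \<comment> \<open>The coordinates in which the unshifted grid separates the two ends of the
    side.\<close>
  define T where "T = {i. \<lfloor>2 ^ j * (a $ i + l) / L\<rfloor> \<noteq> \<lfloor>2 ^ j * a $ i / L\<rfloor>}"
  define s where "s = grid_shift L T"
  define P where "P = grid_cube L s j (\<lambda>i. \<lfloor>2 ^ j * (a $ i - s $ i) / L\<rfloor>)"
  have ends: "\<lfloor>2 ^ j * (a $ i + l - s $ i) / L\<rfloor> = \<lfloor>2 ^ j * (a $ i - s $ i) / L\<rfloor>" for i
  proof (cases "i \<in> T")
    case True
    have "2 ^ j * (a $ i + l) / L = 2 ^ j * a $ i / L + 2 ^ j * l / L"
         "2 ^ j * (a $ i + l - L / 3) / L = 2 ^ j * a $ i / L + 2 ^ j * l / L - 2 ^ j / 3"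
         "2 ^ j * (a $ i - L / 3) / L = 2 ^ j * a $ i / L - 2 ^ j / 3"
      using L by (simp_all add: field_simps)
    moreover have "0 \<le> 2 ^ j * l / L" "2 ^ j * l / L \<le> 1 / 3" using L j assms by (simp_all add: field_simps)
    ultimately show ?thesis
      using True floor_shift_dichotomy[of "2 ^ j * l / L" "2 ^ j * a $ i / L" j]
      by (simp add: T_def s_def grid_shift_def)
  next
    case False
    then show ?thesis by (simp add: T_def s_def grid_shift_def)
  qed
  have "cbox a (a + vec l) \<subseteq> P"
  proof
    fix x assume "x \<in> cbox a (a + vec l)"
    then have x: "a $ i \<le> x $ i" "x $ i \<le> a $ i + l" for i by (auto simp: mem_box_cart)
    have "\<lfloor>2 ^ j * (x $ i - s $ i) / L\<rfloor> = \<lfloor>2 ^ j * (a $ i - s $ i) / L\<rfloor>" for i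
    proof (rule antisym)
      show "\<lfloor>2 ^ j * (a $ i - s $ i) / L\<rfloor> \<le> \<lfloor>2 ^ j * (x $ i - s $ i) / L\<rfloor>"
        using x[of i] L by (intro floor_mono divide_right_mono mult_left_mono) auto
      have "\<lfloor>2 ^ j * (x $ i - s $ i) / L\<rfloor> \<le> \<lfloor>2 ^ j * (a $ i + l - s $ i) / L\<rfloor>"
        using x[of i] L by (intro floor_mono divide_right_mono mult_left_mono) auto
      then show "\<lfloor>2 ^ j * (x $ i - s $ i) / L\<rfloor> \<le> \<lfloor>2 ^ j * (a $ i - s $ i) / L\<rfloor>" by (simp add: ends)
    qed
    then show "x \<in> P" by (simp add: P_def grid_cube_def)
  qed
  moreover have "P \<in> grid L (grid_shift L T)" by (auto simp: grid_def P_def s_def)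
  moreover have "emeasure lebesgue P \<le> ennreal ((6 * l) ^ CARD('n))"
  proof -
    define b where "b = (\<chi> i. s $ i + L / 2 ^ j * of_int \<lfloor>2 ^ j * (a $ i - s $ i) / L\<rfloor>)"
    have "emeasure lebesgue P \<le> emeasure lebesgue (cbox b (b + vec (L / 2 ^ j)))"
      using grid_cube_between(2)[OF L] unfolding P_def b_def by (intro emeasure_mono) auto
    also have "\<dots> = ennreal ((L / 2 ^ j) ^ CARD('n))" using L by (intro emeasure_cube) simp
    also have "\<dots> \<le> ennreal ((6 * l) ^ CARD('n))" using j L by (intro ennreal_leI power_mono) auto
    finally show ?thesis .
  qed
  ultimately show ?thesis using that by blast
qed

section \<open>Maximal functions over cubes\<close>

lemma ennreal_inverse_antimono:
  fixes x y :: ennreal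
  assumes "x \<le> y"
  shows "inverse y \<le> inverse x"
  using assms
  by (cases x rule: ennreal_cases_pos; cases y rule: ennreal_cases_pos)
     (auto simp: inverse_ennreal top_unique ennreal_leI)

lemma measure_cube_epowr:
  fixes c :: "real ^ 'n::finite"
  assumes "l > 0"
  shows "epowr (emeasure lebesgue (cbox c (c + vec l))) r = ennreal ((l ^ CARD('n)) powr r)"
  using assms by (simp only: emeasure_cube less_imp_le epowr_ennreal zero_less_power)

text \<open>Lower semicontinuity holds although the cubes are closed: a cube whose average exceeds
  \<open>a\<close> can be enlarged slightly, keeping the average above \<open>a\<close>, and then
  contains a whole ball around \<open>x\<close>.\<close>

lemma open_frac_maximal_greater:
  fixes h :: "real ^ 'n::finite \<Rightarrow> ennreal"
  shows "open {x. a < frac_maximal \<alpha> h x}"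
proof (rule openI)
  fix x assume "x \<in> {x. a < frac_maximal \<alpha> h x}"
  define r where "r = 1 - \<alpha> / real CARD('n)"
  obtain Q0 where "Q0 \<in> cubes" "x \<in> Q0"
    and less: "a < (\<integral>\<^sup>+y\<in>Q0. h y \<partial>lebesgue) / epowr (emeasure lebesgue Q0) r"
    using \<open>x \<in> _\<close> unfolding frac_maximal_def less_SUP_iff r_def by blast
  then obtain c l where cl: "l > 0" "x \<in> cbox c (c + vec l)" and "Q0 = cbox c (c + vec l)"
    unfolding cubes_def by blast
  note less = less[unfolded this(3) measure_cube_epowr[OF cl(1)]]
  define J where "J = (\<integral>\<^sup>+y\<in>cbox c (c + vec l). h y \<partial>lebesgue)"
  \<comment> \<open>The normalising power for the cube enlarged by \<open>t\<close> on every
    side.\<close>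
  define g where "g t = ((l + 2 * t) ^ CARD('n)) powr r" for t
  have g: "g t > 0" if "t \<ge> 0" for t using cl(1) that by (simp add: g_def)
  have inv: "J / ennreal (g t) = J * ennreal (1 / g t)" if "t \<ge> 0" for t
    using g[OF that] by (simp add: divide_ennreal_def inverse_ennreal inverse_eq_divide)
  have "\<exists>t>0. a < J / ennreal (g t)"
  \<comment> \<open>An infinite integral permits any enlargement; a finite one permits a small
    enlargement, by continuity of \<open>g\<close> at 0.\<close>
  proof (cases "J = top")
    case True
    have "g 1 > 0" by (simp add: g)
    then have "J / ennreal (g 1) = top" using True by (simp add: ennreal_top_divide)
    then show ?thesis using less by (intro exI[of _ 1]) (auto simp: less_top intro: order_less_le_trans)
  next
    case False
    have "((\<lambda>t. J * ennreal (1 / g t)) \<longlongrightarrow> J * ennreal (1 / g 0)) (at_right 0)"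
    proof (rule ennreal_tendsto_cmult)
      show "J < top" using False by (simp add: less_top)
      have "(g \<longlongrightarrow> g 0) (at_right 0)"
        unfolding g_def using cl(1) by (intro tendsto_eq_intros refl) auto
      then show "((\<lambda>t. ennreal (1 / g t)) \<longlongrightarrow> ennreal (1 / g 0)) (at_right 0)"
        using g[of 0] by (intro tendsto_ennrealI tendsto_divide tendsto_const) auto
    qed
    moreover have "a < J * ennreal (1 / g 0)"
      using less inv[of 0] by (simp add: J_def g_def)
    ultimately have "eventually (\<lambda>t. a < J * ennreal (1 / g t)) (at_right 0)"
      by (rule order_tendstoD)
    then have "eventually (\<lambda>t. t > 0 \<and> a < J * ennreal (1 / g t)) (at_right 0)"
      using eventually_at_right_less[of "0::real"] by eventually_elim simp
    then obtain t where "t > 0" "a < J * ennreal (1 / g t)"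
      using eventually_happens' trivial_limit_at_right_real by blast
    then show ?thesis using inv[of t] by auto
  qed
  then obtain t where t: "t > 0" "a < J / ennreal (g t)" by blast
  define Q where "Q = cbox (c - vec t) ((c - vec t) + vec (l + 2 * t))"
  have "l + 2 * t > 0" using cl t by simp
  then have Q: "Q \<in> cubes" unfolding Q_def cubes_def by blast
  have ball: "y \<in> Q" if "y \<in> ball x t" for y
  proof -
    have "\<bar>x $ i - y $ i\<bar> < t" for i
      using that component_le_norm_cart[of "x - y" i] by (simp add: dist_norm)
    then have "c $ i - t \<le> y $ i \<and> y $ i \<le> c $ i - t + (l + 2 * t)" for i
      using cl(2) unfolding mem_box_cart by (simp add: abs_less_iff) (smt (verit))
    then show ?thesis by (simp add: Q_def mem_box_cart)
  qed
  have "cbox c (c + vec l) \<subseteq> Q"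
    using t(1) by (auto simp: Q_def mem_box_cart) (smt (verit))+
  then have "J \<le> (\<integral>\<^sup>+y\<in>Q. h y \<partial>lebesgue)"
    unfolding J_def by (intro nn_integral_mono) (auto split: split_indicator)
  then have "a < (\<integral>\<^sup>+y\<in>Q. h y \<partial>lebesgue) / ennreal (g t)"
    using t(2) by (meson divide_right_mono_ennreal order_less_le_trans)
  also have "ennreal (g t) = epowr (emeasure lebesgue Q) r"
    unfolding Q_def g_def using \<open>l + 2 * t > 0\<close> by (simp only: measure_cube_epowr)
  finally have "a < frac_maximal \<alpha> h y" if "y \<in> ball x t" for y
    unfolding frac_maximal_def less_SUP_iff r_def using Q ball[OF that] by blast
  then show "\<exists>e>0. ball x e \<subseteq> {x. a < frac_maximal \<alpha> h x}" using t(1) by blast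
qed

lemma borel_measurable_frac_maximal [measurable]: "frac_maximal \<alpha> h \<in> borel_measurable borel"
  by (rule borel_measurableI_greater) (simp add: open_frac_maximal_greater)

lemma frac_maximal_ge:
  fixes h :: "real ^ 'n::finite \<Rightarrow> ennreal"
  assumes "Q \<in> cubes" "x \<in> Q"
  shows "(\<integral>\<^sup>+y\<in>Q. h y \<partial>lebesgue) / epowr (emeasure lebesgue Q) (1 - \<alpha> / real CARD('n)) \<le> frac_maximal \<alpha> h x"
  unfolding frac_maximal_def using assms by (intro SUP_upper) auto

lemma cubes_lebesgue: "Q \<in> cubes \<Longrightarrow> Q \<in> sets lebesgue"
  by (auto simp: cubes_def)

section \<open>From shifted dyadic grids to the maximal operator over all cubes\<close>

lemma nn_integral_density_le:
  assumes "u \<in> borel_measurable M" "g \<in> borel_measurable M" "\<And>x. x \<in> space M \<Longrightarrow> h x \<le> u x * g x"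
  shows "(\<integral>\<^sup>+x. h x \<partial>M) \<le> (\<integral>\<^sup>+x. g x \<partial>density M u)"
  using assms by (simp add: nn_integral_density nn_integral_mono)

text \<open>The first factor is the loss of a volume ratio of at most 6^n when a cube is replaced by
  a grid cube, \<open>CARD('n set)\<close> = 2^n counts the shifted grids, and
  \<open>sawyer_const\<close> is the bound on each grid.\<close>

definition sawyer_cube_const :: "'n itself \<Rightarrow> real \<Rightarrow> real \<Rightarrow> real \<Rightarrow> real" where
  "sawyer_cube_const _ r p q = ((6 ^ CARD('n)) powr r) powr q * real CARD('n set) * sawyer_const p q"

context
  fixes \<sigma> u :: "real ^ 'n::finite \<Rightarrow> ennreal" and f :: "real ^ 'n \<Rightarrow> real" and \<alpha> p q :: real and T :: ennreal
  assumes \<alpha>: "\<alpha> < real CARD('n)" and pq: "1 < p" "p \<le> q"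
    and \<sigma> [measurable]: "\<sigma> \<in> borel_measurable lebesgue"
    and u [measurable]: "u \<in> borel_measurable lebesgue"
    and f [measurable]: "f \<in> borel_measurable lebesgue" and f0: "\<And>x. f x \<ge> 0"
    and fin: "\<And>Q. Q \<in> cubes \<Longrightarrow> (\<integral>\<^sup>+x\<in>Q. \<sigma> x \<partial>lebesgue) \<noteq> top"
    and testing: "\<And>Q. Q \<in> cubes \<Longrightarrow>
      (\<integral>\<^sup>+x\<in>Q. epowr (frac_maximal \<alpha> (\<lambda>y. indicator Q y * \<sigma> y) x) q * u x \<partial>lebesgue)
        \<le> T * epowr (\<integral>\<^sup>+x\<in>Q. \<sigma> x \<partial>lebesgue) (q / p)"
    and I: "(\<integral>\<^sup>+x. ennreal (f x powr p) * \<sigma> x \<partial>lebesgue) \<noteq> top"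
begin

definition cube_coeff :: "(real ^ 'n) set \<Rightarrow> ennreal" where
  "cube_coeff Q = inverse (epowr (emeasure lebesgue Q) (1 - \<alpha> / real CARD('n)))"

text \<open>The maximal operator of f\<sigma> restricted to one shifted grid, hence to sides of
  length at most \<open>L\<close>.\<close>

definition dyadic_maximal :: "real \<Rightarrow> 'n set \<Rightarrow> real ^ 'n \<Rightarrow> ennreal" where
  "dyadic_maximal L S x = (SUP Q\<in>grid L (grid_shift L S).
     cube_coeff Q * (\<integral>\<^sup>+y. ennreal (f y) * indicator Q y \<partial>density lebesgue \<sigma>) * indicator Q x)"

lemma measurable_grid_SUP:
  assumes "L > 0" "D \<subseteq> grid L s"
  shows "(\<lambda>x. SUP Q\<in>D. k Q * indicator Q x :: ennreal) \<in> borel_measurable lebesgue"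
proof (rule borel_measurable_SUP)
  show "countable D" using countable_subset[OF assms(2) countable_grid] .
  fix Q assume "Q \<in> D"
  then have [measurable]: "Q \<in> sets lebesgue" using assms grid_lebesgue by blast
  show "(\<lambda>x. k Q * indicator Q x) \<in> borel_measurable lebesgue" by measurable
qed

text \<open>The hypothesis concerns closed cubes. Each grid cube has the volume of a closed cube
  containing it, which bounds the dyadic supremum by the full maximal function; for \<open>R\<close>
  itself the difference is a null set, so both have the same \<sigma>-measure.\<close>

lemma dyadic_testing:
  assumes L: "L > 0" and R: "R \<in> grid L s"
  shows "(\<integral>\<^sup>+x. indicator R x * epowr (SUP Q\<in>{Q\<in>grid L s. Q \<subseteq> R}.
      cube_coeff Q * emeasure (density lebesgue \<sigma>) Q * indicator Q x) q \<partial>density lebesgue u)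
    \<le> T * epowr (emeasure (density lebesgue \<sigma>) R) (q / p)"
proof -
  obtain Q where Q: "Q \<in> cubes" "R \<subseteq> Q" "Q - R \<in> null_sets lebesgue"
    using grid_closure_cube[OF R L] by blast
  have Rm [measurable]: "R \<in> sets lebesgue" using R L by (rule grid_lebesgue)
  let ?S = "\<lambda>x. SUP P\<in>{P\<in>grid L s. P \<subseteq> R}. cube_coeff P * emeasure (density lebesgue \<sigma>) P * indicator P x"
  have [measurable]: "?S \<in> borel_measurable lebesgue"
    using L by (rule measurable_grid_SUP) auto
  have S_le: "?S x \<le> frac_maximal \<alpha> (\<lambda>y. indicator Q y * \<sigma> y) x" for x
  proof (rule SUP_least)
    fix P assume P: "P \<in> {P\<in>grid L s. P \<subseteq> R}"
    then obtain P' where P': "P' \<in> cubes" "P \<subseteq> P'" "P \<in> sets lebesgue" "emeasure lebesgue P = emeasure lebesgue P'"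
      using grid_closure_cube[OF _ L, of P s] grid_lebesgue[OF _ L, of P s] by blast
    show "cube_coeff P * emeasure (density lebesgue \<sigma>) P * indicator P x \<le> frac_maximal \<alpha> (\<lambda>y. indicator Q y * \<sigma> y) x"
    proof (cases "x \<in> P")
      case True
      have "emeasure (density lebesgue \<sigma>) P \<le> (\<integral>\<^sup>+y\<in>P'. indicator Q y * \<sigma> y \<partial>lebesgue)"
        unfolding emeasure_density[OF \<sigma> P'(3)]
      proof (rule nn_integral_mono)
        fix y
        show "\<sigma> y * indicator P y \<le> indicator Q y * \<sigma> y * indicator P' y"
          using P P'(2) Q(2) by (cases "y \<in> P") (auto simp: subset_iff)
      qed
      then have "cube_coeff P * emeasure (density lebesgue \<sigma>) P \<le>
        (\<integral>\<^sup>+y\<in>P'. indicator Q y * \<sigma> y \<partial>lebesgue) / epowr (emeasure lebesgue P') (1 - \<alpha> / real CARD('n))"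
        unfolding cube_coeff_def divide_ennreal_def P'(4) by (subst mult.commute) (rule mult_right_mono, auto)
      also have "\<dots> \<le> frac_maximal \<alpha> (\<lambda>y. indicator Q y * \<sigma> y) x"
        using True P' by (intro frac_maximal_ge) auto
      finally show ?thesis using True by simp
    qed simp
  qed
  have "(\<integral>\<^sup>+x. indicator R x * epowr (?S x) q \<partial>density lebesgue u) =
      (\<integral>\<^sup>+x. u x * (indicator R x * epowr (?S x) q) \<partial>lebesgue)"
    by (rule nn_integral_density) measurable
  also have "\<dots> \<le> (\<integral>\<^sup>+x\<in>Q. epowr (frac_maximal \<alpha> (\<lambda>y. indicator Q y * \<sigma> y) x) q * u x \<partial>lebesgue)"
  proof (rule nn_integral_mono)
    fix x
    have "epowr (?S x) q \<le> epowr (frac_maximal \<alpha> (\<lambda>y. indicator Q y * \<sigma> y) x) q"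
      using pq by (intro epowr_mono S_le) simp
    then show "u x * (indicator R x * epowr (?S x) q) \<le>
        epowr (frac_maximal \<alpha> (\<lambda>y. indicator Q y * \<sigma> y) x) q * u x * indicator Q x"
      using Q(2) by (auto split: split_indicator simp: mult.commute intro!: mult_left_mono)
  qed
  also have "\<dots> \<le> T * epowr (\<integral>\<^sup>+x\<in>Q. \<sigma> x \<partial>lebesgue) (q / p)" by (rule testing[OF Q(1)])
  also have "(\<integral>\<^sup>+x\<in>Q. \<sigma> x \<partial>lebesgue) = emeasure (density lebesgue \<sigma>) R"
    using AE_not_in[OF Q(3)] Q(2)
    by (auto simp: emeasure_density intro!: nn_integral_cong_AE elim!: eventually_mono split: split_indicator)
  finally show ?thesis .
qed

lemma dyadic_sawyer:
  assumes L: "L > 0"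
  shows "(\<integral>\<^sup>+x. epowr (dyadic_maximal L S x) q \<partial>density lebesgue u)
    \<le> ennreal (sawyer_const p q) * T * epowr (\<integral>\<^sup>+x. ennreal (f x powr p) * \<sigma> x \<partial>lebesgue) (q / p)"
proof -
  have D: "grid L (grid_shift L S) \<subseteq> sets lebesgue" using grid_lebesgue[OF _ L] by blast
  have *: "(\<integral>\<^sup>+x. ennreal (f x powr p) \<partial>density lebesgue \<sigma>) = (\<integral>\<^sup>+x. ennreal (f x powr p) * \<sigma> x \<partial>lebesgue)"
    by (subst nn_integral_density) (auto simp: mult.commute)
  have "(\<integral>\<^sup>+x. epowr (dyadic_maximal L S x) q \<partial>density lebesgue u)
    \<le> ennreal (sawyer_const p q) * T * epowr (\<integral>\<^sup>+x. ennreal (f x powr p) \<partial>density lebesgue \<sigma>) (q / p)"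
    unfolding dyadic_maximal_def
  proof (rule sawyer_countable_family[OF countable_grid _ _ _ _ _ f0 pq])
    show "grid L (grid_shift L S) \<subseteq> sets (density lebesgue \<sigma>)" using D by simp
    show "sets (density lebesgue u) = sets (density lebesgue \<sigma>)" by simp
    show "f \<in> borel_measurable (density lebesgue \<sigma>)" by simp
    show "(\<integral>\<^sup>+x. ennreal (f x powr p) \<partial>density lebesgue \<sigma>) \<noteq> top" using I by (simp only: * not_False_eq_True)
    show "emeasure (density lebesgue \<sigma>) Q \<noteq> top" if QD: "Q \<in> grid L (grid_shift L S)" for Q
    proof -
      obtain Q' where Q': "Q' \<in> cubes" "Q \<subseteq> Q'" "Q \<in> sets lebesgue" using grid_closure_cube[OF QD L] grid_lebesgue[OF QD L] by blast
      then have "emeasure (density lebesgue \<sigma>) Q \<le> (\<integral>\<^sup>+x\<in>Q'. \<sigma> x \<partial>lebesgue)"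
        by (auto simp: emeasure_density intro!: nn_integral_mono split: split_indicator)
      then show ?thesis using fin[OF Q'(1)] by (auto simp: top_unique)
    qed
  qed (rule grid_nested dyadic_testing[OF L], assumption+)+
  then show ?thesis by (simp only: *)
qed

text \<open>The cube lies in a grid cube of at most 6^n times its volume. Since
  \<open>\<alpha> < real CARD('n)\<close>, the normalising exponent is positive, and the average
  grows by at most the power of 6^n displayed.\<close>

lemma cube_average_le_dyadic:
  assumes "l > 0" "3 * l \<le> L" "x \<in> cbox a (a + vec l)"
  shows "\<exists>S. (\<integral>\<^sup>+y\<in>cbox a (a + vec l). ennreal (f y) * \<sigma> y \<partial>lebesgue) /
      epowr (emeasure lebesgue (cbox a (a + vec l))) (1 - \<alpha> / real CARD('n))
    \<le> ennreal ((6 ^ CARD('n)) powr (1 - \<alpha> / real CARD('n))) * dyadic_maximal L S x"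
proof -
  define r where "r = 1 - \<alpha> / real CARD('n)"
  have r: "r > 0" using \<alpha> by (simp add: r_def)
  have L: "L > 0" using assms by linarith
  obtain S P where P: "P \<in> grid L (grid_shift L S)" "cbox a (a + vec l) \<subseteq> P"
    "emeasure lebesgue P \<le> ennreal ((6 * l) ^ CARD('n))"
    by (rule cube_in_grid[OF assms(1,2)])
  have [measurable]: "P \<in> sets lebesgue" using P(1) L by (rule grid_lebesgue)
  define \<beta> where "\<beta> = (l ^ CARD('n)) powr r"
  define K where "K = ((6 ^ CARD('n)) powr r :: real)"
  have pos: "\<beta> > 0" "K > 0" using assms(1) by (simp_all add: \<beta>_def K_def)
  have "epowr (emeasure lebesgue P) r \<le> epowr (ennreal ((6 * l) ^ CARD('n))) r"
    using r P(3) by (intro epowr_mono) auto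
  also have "\<dots> = ennreal (K * \<beta>)"
    using assms(1) by (simp add: epowr_ennreal power_mult_distrib powr_mult K_def \<beta>_def)
  finally have le: "inverse (ennreal (K * \<beta>)) \<le> cube_coeff P"
    unfolding cube_coeff_def r_def[symmetric] by (rule ennreal_inverse_antimono)
  have "(\<integral>\<^sup>+y\<in>cbox a (a + vec l). ennreal (f y) * \<sigma> y \<partial>lebesgue) / epowr (emeasure lebesgue (cbox a (a + vec l))) r
    = ennreal K * (inverse (ennreal (K * \<beta>)) * (\<integral>\<^sup>+y\<in>cbox a (a + vec l). ennreal (f y) * \<sigma> y \<partial>lebesgue))"
  proof -
    have eq: "inverse (ennreal \<beta>) = ennreal K * inverse (ennreal (K * \<beta>))"
      using pos by (simp add: inverse_ennreal flip: ennreal_mult)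
    have "X * inverse (ennreal \<beta>) = ennreal K * (inverse (ennreal (K * \<beta>)) * X)" for X
      unfolding eq by (simp only: mult_ac)
    then show ?thesis
      unfolding measure_cube_epowr[OF assms(1)] divide_ennreal_def \<beta>_def[symmetric] .
  qed
  also have "\<dots> \<le> ennreal K * (cube_coeff P * (\<integral>\<^sup>+y. ennreal (f y) * indicator P y \<partial>density lebesgue \<sigma>) * indicator P x)"
  proof -
    have "(\<integral>\<^sup>+y\<in>cbox a (a + vec l). ennreal (f y) * \<sigma> y \<partial>lebesgue) \<le>
        (\<integral>\<^sup>+y. ennreal (f y) * indicator P y \<partial>density lebesgue \<sigma>)"
    proof (rule nn_integral_density_le[OF \<sigma>])
      show "(\<lambda>y. ennreal (f y) * indicator P y) \<in> borel_measurable lebesgue" by measurable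
      show "ennreal (f y) * \<sigma> y * indicator (cbox a (a + vec l)) y \<le> \<sigma> y * (ennreal (f y) * indicator P y)" for y
      proof (cases "y \<in> cbox a (a + vec l)")
        case True
        then have "y \<in> P" using P(2) by blast
        then show ?thesis using True by (simp add: mult.commute)
      qed simp
    qed
    then have "inverse (ennreal (K * \<beta>)) * (\<integral>\<^sup>+y\<in>cbox a (a + vec l). ennreal (f y) * \<sigma> y \<partial>lebesgue) \<le>
        cube_coeff P * (\<integral>\<^sup>+y. ennreal (f y) * indicator P y \<partial>density lebesgue \<sigma>)"
      by (intro mult_mono le zero_le)
    moreover have "indicator P x = (1 :: ennreal)" using assms(3) P(2) by (intro indicator_simps(1)) blast
    ultimately show ?thesis by (simp only: mult_1_right mult_left_mono zero_le)
  qed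
  also have "\<dots> \<le> ennreal K * dyadic_maximal L S x"
    unfolding dyadic_maximal_def using P(1) by (intro mult_left_mono SUP_upper) auto
  finally show ?thesis unfolding r_def K_def by (rule exI)
qed

lemma sawyer_cubes:
  "(\<integral>\<^sup>+x. epowr (frac_maximal \<alpha> (\<lambda>y. ennreal (f y) * \<sigma> y) x) q * u x \<partial>lebesgue)
    \<le> ennreal (sawyer_cube_const TYPE('n) (1 - \<alpha> / real CARD('n)) p q) * T *
       epowr (\<integral>\<^sup>+x. ennreal (f x powr p) * \<sigma> x \<partial>lebesgue) (q / p)"
proof -
  define K where "K = ((6 ^ CARD('n)) powr (1 - \<alpha> / real CARD('n)) :: real)"
  have K: "K > 0" by (simp add: K_def)
  have q: "q > 0" using pq by simp
  define B where "B = ennreal (sawyer_const p q) * T * epowr (\<integral>\<^sup>+x. ennreal (f x powr p) * \<sigma> x \<partial>lebesgue) (q / p)"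
  \<comment> \<open>Summing over all shifts avoids having to know which shift serves a given
    cube.\<close>
  define G where "G k x = ennreal (K powr q) * (\<Sum>S\<in>UNIV. epowr (dyadic_maximal (real (Suc k)) S x) q)" for k x
  have dm: "dyadic_maximal (real (Suc k)) S \<in> borel_measurable lebesgue" for k S
    unfolding dyadic_maximal_def by (rule measurable_grid_SUP) auto
  have Gm: "G k \<in> borel_measurable lebesgue" for k
    unfolding G_def
    by (intro borel_measurable_times_ennreal borel_measurable_const borel_measurable_sum measurable_epowr dm)
  \<comment> \<open>A fixed cube is small relative to \<open>L = k + 1\<close> for all large
    \<open>k\<close>. The grids for different \<open>k\<close> need not be nested, hence the lower
    limit and Fatou's lemma in place of monotone convergence.\<close>
  have pointwise: "epowr (frac_maximal \<alpha> (\<lambda>y. ennreal (f y) * \<sigma> y) x) q \<le> liminf (\<lambda>k. G k x)" for x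
    unfolding epowr_le_iff[OF q] unfolding frac_maximal_def
  proof (rule SUP_least)
    fix Q :: "(real ^ 'n) set" assume "Q \<in> {Q \<in> cubes. x \<in> Q}"
    then obtain a l where l: "l > 0" and Q: "Q = cbox a (a + vec l)" "x \<in> cbox a (a + vec l)"
      by (auto simp: cubes_def)
    let ?A = "(\<integral>\<^sup>+y\<in>Q. ennreal (f y) * \<sigma> y \<partial>lebesgue) / epowr (emeasure lebesgue Q) (1 - \<alpha> / real CARD('n))"
    have "eventually (\<lambda>k. 3 * l \<le> real k) sequentially"
      using filterlim_real_sequentially unfolding filterlim_at_top by blast
    then have "eventually (\<lambda>k. epowr ?A q \<le> G k x) sequentially"
    proof eventually_elim
      case (elim k)
      then obtain S where "?A \<le> ennreal K * dyadic_maximal (real (Suc k)) S x"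
        using cube_average_le_dyadic[OF l _ Q(2), of "real (Suc k)"] by (auto simp: Q(1) K_def)
      then have "epowr ?A q \<le> epowr (ennreal K * dyadic_maximal (real (Suc k)) S x) q"
        using q by (intro epowr_mono) auto
      also have "\<dots> = ennreal (K powr q) * epowr (dyadic_maximal (real (Suc k)) S x) q"
        using q K by (simp add: epowr_mult epowr_ennreal)
      also have "\<dots> \<le> G k x"
        unfolding G_def by (intro mult_left_mono member_le_sum) auto
      finally show ?case .
    qed
    then have "epowr ?A q \<le> liminf (\<lambda>k. G k x)" by (rule Liminf_bounded)
    then show "?A \<le> epowr (liminf (\<lambda>k. G k x)) (1 / q)" by (simp add: epowr_le_iff[OF q])
  qed
  have "(\<integral>\<^sup>+x. epowr (frac_maximal \<alpha> (\<lambda>y. ennreal (f y) * \<sigma> y) x) q * u x \<partial>lebesgue)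
    \<le> (\<integral>\<^sup>+x. liminf (\<lambda>k. G k x) \<partial>density lebesgue u)"
  proof (rule nn_integral_density_le[OF u])
    show "(\<lambda>x. liminf (\<lambda>k. G k x)) \<in> borel_measurable lebesgue"
      by (intro borel_measurable_liminf Gm)
    show "epowr (frac_maximal \<alpha> (\<lambda>y. ennreal (f y) * \<sigma> y) x) q * u x \<le> u x * liminf (\<lambda>k. G k x)" for x
      by (subst mult.commute) (intro mult_left_mono pointwise zero_le)
  qed
  also have "\<dots> \<le> liminf (\<lambda>k. \<integral>\<^sup>+x. G k x \<partial>density lebesgue u)"
    by (rule nn_integral_liminf) (simp add: Gm)
  also have "\<dots> \<le> liminf (\<lambda>k. ennreal (K powr q) * (of_nat CARD('n set) * B))"
  proof (intro Liminf_mono always_eventually allI)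
    fix k
    have m: "(\<lambda>x. epowr (dyadic_maximal (real (Suc k)) S x) q) \<in> borel_measurable (density lebesgue u)" for S
      unfolding measurable_density_eq1 by (rule measurable_epowr) (rule dm)
    have "(\<integral>\<^sup>+x. G k x \<partial>density lebesgue u) =
        ennreal (K powr q) * (\<integral>\<^sup>+x. (\<Sum>S\<in>UNIV. epowr (dyadic_maximal (real (Suc k)) S x) q) \<partial>density lebesgue u)"
      unfolding G_def by (rule nn_integral_cmult) (intro borel_measurable_sum m)
    also have "(\<integral>\<^sup>+x. (\<Sum>S\<in>UNIV. epowr (dyadic_maximal (real (Suc k)) S x) q) \<partial>density lebesgue u) =
        (\<Sum>S\<in>UNIV. \<integral>\<^sup>+x. epowr (dyadic_maximal (real (Suc k)) S x) q \<partial>density lebesgue u)"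
      by (rule nn_integral_sum) (rule m)
    also have "ennreal (K powr q) * \<dots> \<le> ennreal (K powr q) * (\<Sum>S\<in>(UNIV :: 'n set set). B)"
      unfolding B_def by (intro mult_left_mono sum_mono dyadic_sawyer) auto
    finally show "(\<integral>\<^sup>+x. G k x \<partial>density lebesgue u) \<le> ennreal (K powr q) * (of_nat CARD('n set) * B)"
      by simp
  qed
  also have "\<dots> = ennreal (K powr q) * (of_nat CARD('n set) * B)" by (simp add: Liminf_const)
  also have "\<dots> = ennreal (sawyer_cube_const TYPE('n) (1 - \<alpha> / real CARD('n)) p q) * T *
       epowr (\<integral>\<^sup>+x. ennreal (f x powr p) * \<sigma> x \<partial>lebesgue) (q / p)"
    by (simp add: sawyer_cube_const_def B_def K_def ennreal_mult'' ennreal_mult' ennreal_of_nat_eq_real_of_nat ac_simps)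
  finally show ?thesis .
qed

end

section \<open>Linear changes of variables\<close>

text \<open>The shear result for intervals expects a nonnegative lower end in coordinate
  \<open>k\<close>. Translating by \<open>v\<close> moves that end to 0, and additivity of
  \<open>f\<close> turns this into a translation of the image.\<close>

lemma measure_shear_cbox:
  fixes a b :: "real ^ 'n::finite"
  assumes "m \<noteq> k"
  defines "f \<equiv> \<lambda>x :: real ^ 'n. \<chi> i. if i = m then x $ m + x $ k else x $ i"
  shows "measure lebesgue (f ` cbox a b) = measure lebesgue (cbox a b)"
proof (cases "cbox a b = {}")
  case False
  define v where "v = axis k (a $ k)"
  have eq: "cbox a b = (+) v ` cbox (a - v) (b - v)"
    using cbox_translation[of v "a - v" "b - v"] by simp
  have "f (v + x) = f v + f x" for x
    by (simp add: f_def vec_eq_iff)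
  then have "f ` cbox a b = (+) (f v) ` (f ` cbox (a - v) (b - v))"
    by (simp add: eq image_image)
  then have "measure lebesgue (f ` cbox a b) = measure lebesgue (f ` cbox (a - v) (b - v))"
    by (simp only: measure_translation)
  also have "\<dots> = measure lebesgue (cbox (a - v) (b - v))"
    unfolding f_def using assms(1) False eq by (intro measure_shear_interval) (auto simp: v_def)
  also have "\<dots> = measure lebesgue (cbox a b)"
    by (simp only: eq measure_translation)
  finally show ?thesis .
qed simp

lemma measure_permute_cbox:
  fixes a b :: "real ^ 'n::finite"
  assumes "\<pi> permutes (UNIV :: 'n set)"
  defines "f \<equiv> \<lambda>x :: real ^ 'n. \<chi> i. x $ \<pi> i"
  shows "measure lebesgue (f ` cbox a b) = measure lebesgue (cbox a b)"
proof (cases "cbox a b = {}")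
  case False
  have img: "f ` cbox a b = cbox (f a) (f b)"
  proof (intro equalityI subsetI)
    fix y assume "y \<in> cbox (f a) (f b)"
    then have "a $ i \<le> y $ inv \<pi> i \<and> y $ inv \<pi> i \<le> b $ i" for i
      using permutes_inverses(1)[OF assms(1)] unfolding mem_box_cart f_def by (metis vec_lambda_beta)
    then have "(\<chi> i. y $ inv \<pi> i) \<in> cbox a b" by (simp add: mem_box_cart)
    moreover have "y = f (\<chi> i. y $ inv \<pi> i)"
      by (simp add: f_def vec_eq_iff permutes_inverses(2)[OF assms(1)])
    ultimately show "y \<in> f ` cbox a b" by blast
  qed (auto simp: mem_box_cart f_def)
  have "cbox (f a) (f b) \<noteq> {}" using False by (simp flip: img)
  then have "measure lebesgue (f ` cbox a b) = (\<Prod>i\<in>UNIV. (b - a) $ \<pi> i)"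
    by (simp add: img content_cbox_cart) (simp add: f_def)
  also have "\<dots> = (\<Prod>i\<in>UNIV. (b - a) $ i)"
    using prod.permute[OF assms(1), of "\<lambda>i. (b - a) $ i"] by (simp add: o_def)
  finally show ?thesis using False by (simp add: content_cbox_cart)
qed simp

text \<open>
  The library states \<open>measure_linear_image\<close> only for well-ordered index types; the dimension here is an arbitrary
  finite type.
\<close>

proposition measure_matrix_image:
  fixes A :: "real ^ 'n::finite ^ 'n"
  assumes "det A \<noteq> 0" "S \<in> lmeasurable"
  shows "(*v) A ` S \<in> lmeasurable \<and> measure lebesgue ((*v) A ` S) = \<bar>det A\<bar> * measure lebesgue S"
proof -
  \<comment> \<open>Making invertibility a premise of \<open>P\<close> renders the zero-row case of
    the induction vacuous.\<close>
  define P where "P = (\<lambda>A :: real ^ 'n ^ 'n. det A \<noteq> 0 \<longrightarrow> (\<forall>S\<in>lmeasurable.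
    (*v) A ` S \<in> lmeasurable \<and> measure lebesgue ((*v) A ` S) = \<bar>det A\<bar> * measure lebesgue S))"
  \<comment> \<open>For elementary matrices with determinant of modulus 1 it is enough to preserve
    the volume of boxes.\<close>
  have suff: "P B" if "\<And>a b. measure lebesgue ((*v) B ` cbox a b) = measure lebesgue (cbox a b)" "\<bar>det B\<bar> = 1" for B
    unfolding P_def
  proof (intro impI ballI)
    fix S :: "(real ^ 'n) set" assume "S \<in> lmeasurable"
    then show "(*v) B ` S \<in> lmeasurable \<and> measure lebesgue ((*v) B ` S) = \<bar>det B\<bar> * measure lebesgue S"
      using measure_linear_sufficient[of "(*v) B" S 1] that by (metis lambda_one matrix_vector_mul_linear)
  qed
  have "P A"
  proof (rule induct_matrix_elementary_alt)
    fix A B :: "real ^ 'n ^ 'n" assume AB: "P A" "P B"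
    show "P (A ** B)"
      unfolding P_def
    proof (intro impI ballI)
      fix S :: "(real ^ 'n) set" assume S: "S \<in> lmeasurable" and "det (A ** B) \<noteq> 0"
      then have "det A \<noteq> 0" "det B \<noteq> 0" by (auto simp: det_mul)
      moreover have "(*v) (A ** B) ` S = (*v) A ` ((*v) B ` S)"
        by (simp add: image_image matrix_vector_mul_assoc)
      ultimately show "(*v) (A ** B) ` S \<in> lmeasurable \<and>
          measure lebesgue ((*v) (A ** B) ` S) = \<bar>det (A ** B)\<bar> * measure lebesgue S"
        using AB S by (simp add: P_def det_mul abs_mult)
    qed
  next
    fix A :: "real ^ 'n ^ 'n" and i assume "row i A = 0"
    then show "P A" by (auto simp: P_def det_zero_row)
  next
    fix A :: "real ^ 'n ^ 'n" assume diag: "\<And>i j. i \<noteq> j \<Longrightarrow> A $ i $ j = 0"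
    have "A $ i $ i * x $ i = (\<Sum>j\<in>UNIV. A $ i $ j * x $ j)" for x i
      by (subst sum.remove[of _ i]) (auto simp: diag)
    then have "(*v) A = (\<lambda>x. \<chi> i. A $ i $ i * x $ i)"
      by (simp add: matrix_vector_mult_def fun_eq_iff)
    then show "P A"
      by (simp add: P_def det_diagonal diag measurable_stretch measure_stretch)
  next
    fix m k :: 'n assume "m \<noteq> k"
    let ?\<pi> = "Transposition.transpose m k"
    let ?B = "(\<chi> i j. mat 1 $ i $ ?\<pi> j) :: real ^ 'n ^ 'n"
    have perm: "?\<pi> permutes UNIV" by (simp add: permutes_swap_id)
    show "P ?B"
    proof (rule suff)
      have "(\<Sum>j\<in>UNIV. (mat 1 :: real ^ 'n ^ 'n) $ i $ ?\<pi> j * x $ j) = x $ ?\<pi> i" for x :: "real ^ 'n" and i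
      proof -
        have swap: "i = ?\<pi> j \<longleftrightarrow> j = ?\<pi> i" for j by (metis transpose_involutory)
        have "(mat 1 :: real ^ 'n ^ 'n) $ i $ ?\<pi> j * x $ j = (if j = ?\<pi> i then x $ j else 0)" for j
          unfolding mat_def using swap[of j] by simp
        then show ?thesis by simp
      qed
      then have "(*v) ?B = (\<lambda>x. \<chi> i. x $ ?\<pi> i)"
        by (simp add: matrix_vector_mult_def fun_eq_iff)
      then show "measure lebesgue ((*v) ?B ` cbox a b) = measure lebesgue (cbox a b)" for a b
        using measure_permute_cbox[OF perm, of a b] by simp
      show "\<bar>det ?B\<bar> = 1"
        using det_permute_columns[OF perm, of "mat 1 :: real ^ 'n ^ 'n"] by (simp add: sign_def)
    qed
  next
    fix m k :: 'n assume mk: "m \<noteq> k"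
    let ?B = "(\<chi> i j. of_bool (i = m \<and> j = k \<or> i = j)) :: real ^ 'n ^ 'n"
    show "P ?B"
    proof (rule suff)
      have "(\<Sum>j\<in>UNIV. of_bool (i = m \<and> j = k \<or> i = j) * x $ j) = (if i = m then x $ m + x $ k else x $ i)"
        for x :: "real ^ 'n" and i
      proof -
        have "of_bool (i = m \<and> j = k \<or> i = j) * x $ j =
            (if j = i then x $ j else 0) + (if j = k then (if i = m then x $ j else 0) else 0)" for j
          using mk by auto
        then show ?thesis by (simp add: sum.distrib)
      qed
      then have "(*v) ?B = (\<lambda>x. \<chi> i. if i = m then x $ m + x $ k else x $ i)"
        by (simp add: matrix_vector_mult_def fun_eq_iff)
      then show "measure lebesgue ((*v) ?B ` cbox a b) = measure lebesgue (cbox a b)" for a b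
        using measure_shear_cbox[OF mk, of a b] by simp
      have "?B = (\<chi> i. if i = m then row m (mat 1) + 1 *s row k (mat 1) else row i (mat 1))"
        using mk unfolding vec_eq_iff row_def mat_def by simp
      then show "\<bar>det ?B\<bar> = 1"
        using det_row_operation[OF mk, of "mat 1 :: real ^ 'n ^ 'n" 1] by simp
    qed
  qed
  then show ?thesis using assms by (simp add: P_def)
qed

section \<open>Lebesgue measure under an invertible matrix\<close>

context
  fixes A :: "real ^ 'n::finite ^ 'n"
  assumes A: "invertible A"
begin

text \<open>Lebesgue measure is determined by its values on boxes. The preimage \<open>V\<close> of
  a box is open and bounded, and its image under \<open>A\<close> is the box again, so the volume
  formula for \<open>A\<close> applies to \<open>V\<close>.\<close>

lemma lborel_matrix: "lborel = density (distr lborel borel ((*v) A)) (\<lambda>_. ennreal \<bar>det A\<bar>)"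
proof (rule lborel_eqI)
  have cont: "continuous_on UNIV ((*v) A)"
    by (simp add: linear_continuous_on linear_linear)
  then have [measurable]: "(*v) A \<in> borel_measurable borel"
    by (rule borel_measurable_continuous_onI)
  obtain B where B: "A ** B = mat 1" "B ** A = mat 1" using A by (auto simp: invertible_def)
  fix l u :: "real ^ 'n" assume le: "\<And>b. b \<in> Basis \<Longrightarrow> l \<bullet> b \<le> u \<bullet> b"
  define V where "V = (*v) A -` box l u"
  have V_eq: "V = (*v) B ` box l u"
  proof -
    have inv: "A *v (B *v y) = y" "B *v (A *v y) = y" for y
      using B by (simp_all add: matrix_vector_mul_assoc)
    show ?thesis unfolding V_def
    proof (intro equalityI subsetI)
      fix y assume "y \<in> (*v) A -` box l u"
      then show "y \<in> (*v) B ` box l u" using inv(2)[of y] by (intro image_eqI[of _ _ "A *v y"]) auto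
    qed (auto simp: inv(1))
  qed
  have "bounded V" unfolding V_eq by (intro bounded_linear_image bounded_box) (simp add: linear_linear)
  moreover have "open V" unfolding V_def using cont by (intro open_vimage) auto
  ultimately have V: "V \<in> lmeasurable" by (simp add: lmeasurable_open)
  have img: "(*v) A ` V = box l u"
  proof -
    have "surj ((*v) A)" using B by (metis matrix_right_invertible_surjective)
    then show ?thesis by (simp add: V_def surj_image_vimage_eq)
  qed
  have "measure lebesgue (box l u) = \<bar>det A\<bar> * measure lebesgue V"
    using measure_matrix_image[OF _ V, of A] A by (simp add: img invertible_det_nz)
  then have "emeasure lebesgue (box l u) = ennreal \<bar>det A\<bar> * emeasure lebesgue V"
    using V by (simp add: emeasure_eq_measure2 ennreal_mult)
  moreover have "V \<in> sets borel" using \<open>open V\<close> by simp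
  ultimately show "emeasure (density (distr lborel borel ((*v) A)) (\<lambda>_. ennreal \<bar>det A\<bar>)) (box l u) = (\<Prod>b\<in>Basis. (u - l) \<bullet> b)"
    using le by (simp add: emeasure_density nn_integral_cmult emeasure_distr V_def)
qed simp

text \<open>Agreement of the null sets lets the push-forward commute with completion, and so carries
  the Borel statement over to Lebesgue measurable functions.\<close>

lemma null_sets_lborel_matrix: "null_sets lborel = null_sets (distr lebesgue lborel ((*v) A))"
proof -
  have [measurable]: "(*v) A \<in> borel_measurable borel"
    by (intro borel_measurable_continuous_onI) (simp add: linear_continuous_on linear_linear)
  have "emeasure lborel X = 0 \<longleftrightarrow> emeasure (distr lebesgue lborel ((*v) A)) X = 0" if "X \<in> sets borel" for X
  proof -
    have "emeasure lborel X = ennreal \<bar>det A\<bar> * emeasure (distr lborel borel ((*v) A)) X"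
      using that by (subst lborel_matrix) (simp add: emeasure_density nn_integral_cmult)
    moreover have "distr lebesgue lborel ((*v) A) = distr lborel borel ((*v) A)"
      by (simp add: distr_completion cong: distr_cong)
    ultimately show ?thesis using A by (simp add: invertible_det_nz)
  qed
  then show ?thesis by (auto simp: null_sets_def)
qed

lemma measurable_matrix_lebesgue: "(*v) A \<in> lebesgue \<rightarrow>\<^sub>M lebesgue"
proof -
  have "(*v) A \<in> borel_measurable borel"
    by (intro borel_measurable_continuous_onI) (simp add: linear_continuous_on linear_linear)
  then show ?thesis
    by (simp add: completion.measurable_completion2 null_sets_lborel_matrix measurable_completion)
qed

lemma lebesgue_matrix: "lebesgue = density (distr lebesgue lebesgue ((*v) A)) (\<lambda>_. ennreal \<bar>det A\<bar>)"
proof -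
  have m: "(*v) A \<in> borel_measurable borel"
    by (intro borel_measurable_continuous_onI) (simp add: linear_continuous_on linear_linear)
  have "lebesgue = completion (density (distr lborel borel ((*v) A)) (\<lambda>_. ennreal \<bar>det A\<bar>))"
    by (subst lborel_matrix) simp
  also have "\<dots> = density (completion (distr lebesgue lborel ((*v) A))) (\<lambda>_. ennreal \<bar>det A\<bar>)"
    using m A by (auto intro!: completion_density_eq simp: distr_completion invertible_det_nz cong: distr_cong)
  also have "\<dots> = density (distr lebesgue lebesgue ((*v) A)) (\<lambda>_. ennreal \<bar>det A\<bar>)"
    using m by (subst completion.completion_distr_eq) (auto simp: null_sets_lborel_matrix measurable_completion)
  finally show ?thesis .
qed

lemma nn_integral_matrix:
  assumes F: "F \<in> borel_measurable lebesgue"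
  shows "(\<integral>\<^sup>+x. F x \<partial>lebesgue) = ennreal \<bar>det A\<bar> * (\<integral>\<^sup>+x. F (A *v x) \<partial>lebesgue)"
proof -
  note measurable_matrix_lebesgue[measurable] F[measurable]
  have "(\<integral>\<^sup>+x. F x \<partial>lebesgue) = (\<integral>\<^sup>+x. F x \<partial>density (distr lebesgue lebesgue ((*v) A)) (\<lambda>_. ennreal \<bar>det A\<bar>))"
    using lebesgue_matrix by simp
  also have "\<dots> = (\<integral>\<^sup>+x. ennreal \<bar>det A\<bar> * F x \<partial>distr lebesgue lebesgue ((*v) A))"
    by (rule nn_integral_density) simp_all
  also have "\<dots> = (\<integral>\<^sup>+x. ennreal \<bar>det A\<bar> * F (A *v x) \<partial>lebesgue)"
    by (rule nn_integral_distr) simp_all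
  also have "\<dots> = ennreal \<bar>det A\<bar> * (\<integral>\<^sup>+x. F (A *v x) \<partial>lebesgue)"
    by (rule nn_integral_cmult) (use measurable_compose[OF measurable_matrix_lebesgue F] in simp)
  finally show ?thesis .
qed

end

section \<open>The testing class and the weighted inequality\<close>

lemma compact_subset_cube:
  fixes K :: "(real ^ 'n::finite) set"
  assumes "compact K"
  obtains Q where "Q \<in> cubes" "K \<subseteq> Q"
proof -
  obtain b where b: "b > 0" "\<And>x. x \<in> K \<Longrightarrow> norm x \<le> b"
    using compact_imp_bounded[OF assms] unfolding bounded_pos by blast
  have "- b \<le> x $ i \<and> x $ i \<le> b" if "x \<in> K" for x i
    using component_le_norm_cart[of x i] b(2)[OF that] by linarith
  then have "K \<subseteq> cbox (- vec b) (- vec b + vec (2 * b))"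
    by (auto simp: mem_box_cart)
  moreover have "2 * b > 0" using b by simp
  then have "cbox (- vec b) (- vec b + vec (2 * b)) \<in> cubes" unfolding cubes_def by blast
  ultimately show ?thesis using that by blast
qed

lemma weight_iff_cubes:
  fixes v :: "real ^ 'n::finite \<Rightarrow> ennreal"
  shows "weight v \<longleftrightarrow> v \<in> borel_measurable lebesgue \<and> (\<forall>Q\<in>cubes. (\<integral>\<^sup>+x\<in>Q. v x \<partial>lebesgue) \<noteq> top)"
proof -
  have "(\<integral>\<^sup>+x\<in>K. v x \<partial>lebesgue) < \<infinity>"
    if Q: "\<forall>Q\<in>cubes. (\<integral>\<^sup>+x\<in>Q. v x \<partial>lebesgue) \<noteq> top" and K: "compact K" for K
  proof -
    obtain Q where "Q \<in> cubes" "K \<subseteq> Q" by (rule compact_subset_cube[OF K])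
    then have "(\<integral>\<^sup>+x\<in>K. v x \<partial>lebesgue) \<le> (\<integral>\<^sup>+x\<in>Q. v x \<partial>lebesgue)"
      by (intro nn_integral_mono) (auto split: split_indicator)
    also have "\<dots> < \<infinity>" using Q \<open>Q \<in> cubes\<close> by (simp add: less_top)
    finally show ?thesis .
  qed
  moreover have "compact Q" if "Q \<in> cubes" for Q :: "(real ^ 'n) set"
    using that by (auto simp: cubes_def)
  ultimately show ?thesis unfolding weight_def by (auto simp: less_top)
qed

lemma weight_AE_finite:
  fixes v :: "real ^ 'n::finite \<Rightarrow> ennreal"
  assumes "weight v"
  shows "AE x in lebesgue. v x \<noteq> top"
proof -
  have v [measurable]: "v \<in> borel_measurable lebesgue" using assms by (simp add: weight_def)
  have "AE x in lebesgue. v x * indicator (cball 0 (real k)) x \<noteq> \<infinity>" for k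
  proof (rule nn_integral_PInf_AE)
    show "(\<lambda>x. v x * indicator (cball 0 (real k)) x) \<in> borel_measurable lebesgue"
      by (intro borel_measurable_times_ennreal v borel_measurable_indicator) simp
    show "(\<integral>\<^sup>+x\<in>cball 0 (real k). v x \<partial>lebesgue) \<noteq> \<infinity>"
      using assms compact_cball[of "0 :: real ^ 'n" "real k"] unfolding weight_def by (auto simp: less_top)
  qed
  then have "AE x in lebesgue. \<forall>k. v x * indicator (cball 0 (real k)) x \<noteq> \<infinity>"
    by (simp add: AE_all_countable)
  then show ?thesis
  proof eventually_elim
    case (elim x)
    obtain k where "norm x \<le> real k" using real_arch_simple by blast
    then show ?case using elim[rule_format, of k] by simp
  qed
qed

lemma cube_emeasure_pos_finite:
  fixes Q :: "(real ^ 'n::finite) set"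
  assumes "Q \<in> cubes"
  shows "emeasure lebesgue Q \<noteq> 0" "emeasure lebesgue Q \<noteq> top"
proof -
  obtain a l where "l > 0" "Q = cbox a (a + vec l)" using assms by (auto simp: cubes_def)
  then have "emeasure lebesgue Q = ennreal (l ^ CARD('n))" "l > 0" by (simp_all only: emeasure_cube less_imp_le)
  then show "emeasure lebesgue Q \<noteq> 0" "emeasure lebesgue Q \<noteq> top" by simp_all
qed

lemma nn_integral_cube_pos:
  fixes v :: "real ^ 'n::finite \<Rightarrow> ennreal"
  assumes Q: "Q \<in> cubes" and v: "v \<in> borel_measurable lebesgue" and pos: "AE x in lebesgue. v x \<noteq> 0"
  shows "(\<integral>\<^sup>+x\<in>Q. v x \<partial>lebesgue) \<noteq> 0"
proof
  have [measurable]: "Q \<in> sets lebesgue" by (rule cubes_lebesgue[OF Q])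
  note v [measurable]
  assume "(\<integral>\<^sup>+x\<in>Q. v x \<partial>lebesgue) = 0"
  then have "AE x in lebesgue. v x * indicator Q x = 0"
    by (subst (asm) nn_integral_0_iff_AE) auto
  with pos have "AE x in lebesgue. x \<notin> Q"
    by eventually_elim (auto split: split_indicator_asm)
  then have "emeasure lebesgue Q = 0" by (subst (asm) AE_iff_measurable[of Q]) auto
  then show False using cube_emeasure_pos_finite(1)[OF Q] by simp
qed

text \<open>The change of variables, applied to the indicator of a null set, shows that its preimage
  under \<open>A\<close> is null.\<close>

lemma AE_matrix:
  fixes A :: "real ^ 'n::finite ^ 'n"
  assumes A: "invertible A" and P: "AE x in lebesgue. P x"
  shows "AE x in lebesgue. P (A *v x)"
proof -
  obtain N where N: "{x. \<not> P x} \<subseteq> N" "N \<in> null_sets lebesgue"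
    using P by (auto simp: eventually_ae_filter)
  have "0 = (\<integral>\<^sup>+x. indicator N x \<partial>lebesgue)" using N by (simp add: null_setsD1 null_setsD2)
  also have "\<dots> = ennreal \<bar>det A\<bar> * (\<integral>\<^sup>+x. indicator N (A *v x) \<partial>lebesgue)"
    using N by (intro nn_integral_matrix[OF A] borel_measurable_indicator null_setsD2)
  finally have "(\<integral>\<^sup>+x. indicator N (A *v x) \<partial>lebesgue) = (0 :: ennreal)"
    using A by (auto simp: invertible_det_nz)
  moreover have "(\<lambda>x. indicator N (A *v x) :: ennreal) \<in> borel_measurable lebesgue"
    using measurable_compose[OF measurable_matrix_lebesgue[OF A] borel_measurable_indicator] N null_setsD2 by blast
  ultimately have "AE x in lebesgue. indicator N (A *v x) = (0 :: ennreal)"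
    by (subst (asm) nn_integral_0_iff_AE)
  then show ?thesis by eventually_elim (use N(1) in \<open>auto split: split_indicator_asm\<close>)
qed

lemma matrix_inv_inverse:
  fixes A :: "'a::semiring_1 ^ 'n ^ 'm"
  assumes "invertible A"
  shows "A ** matrix_inv A = mat 1 \<and> matrix_inv A ** A = mat 1"
  using assms unfolding invertible_def matrix_inv_def by (rule someI_ex)

lemma sawyer_cube_const_pos:
  assumes "1 < p"
  shows "sawyer_cube_const TYPE('n::finite) r p q > 0"
proof -
  have "2 powr (1 - p) < (1 :: real)" using assms powr_less_mono[of "1 - p" 0 2] by simp
  then have "1 - 2 powr (1 - p) > 0" by simp
  then have "2 powr p / (1 - 2 powr (1 - p)) > 0" by (intro divide_pos_pos) simp_all
  then show ?thesis
    unfolding sawyer_cube_const_def sawyer_const_def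
    by (intro mult_pos_pos) (simp_all only: powr_gt_zero, simp_all)
qed

lemma exponent_bounds:
  fixes \<alpha> p q n :: real
  assumes "0 \<le> \<alpha>" "\<alpha> < n" "1 < p" "\<alpha> > 0 \<Longrightarrow> p < n / \<alpha>" "1 / q = 1 / p - \<alpha> / n"
  shows "p \<le> q"
proof -
  \<comment> \<open>The convention that n / \<alpha> is infinite for \<alpha> = 0 is what requires
    the case distinction.\<close>
  have "\<alpha> / n < 1 / p"
    using assms by (cases "\<alpha> = 0") (auto simp: field_simps)
  then have "1 / q > 0" "1 / q \<le> 1 / p" using assms by auto
  then show ?thesis using assms(3) by (simp add: field_simps zero_less_divide_iff)
qed

section \<open>The weighted inequality as a two-weight inequality\<close>

context
  fixes A :: "real ^ 'n::finite ^ 'n" and w :: "real ^ 'n \<Rightarrow> ennreal" and \<alpha> p q :: real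
  assumes A: "invertible A" and w: "weight w" and \<alpha>: "\<alpha> < real CARD('n)" and p: "1 < p" and pq: "p \<le> q"
begin

text \<open>\<open>dual\<close> and \<open>pulled\<close> are the pair \<sigma>, u to which Sawyer's
  theorem is applied.\<close>

definition dual :: "real ^ 'n \<Rightarrow> ennreal" where
  "dual x = epowr (w x) (- conj_exponent p)"

definition pulled :: "real ^ 'n \<Rightarrow> ennreal" where
  "pulled x = epowr (w (A *v x)) q"

lemma w_measurable [measurable]: "w \<in> borel_measurable lebesgue"
  using w by (simp add: weight_def)

lemma dual_measurable [measurable]: "dual \<in> borel_measurable lebesgue"
  unfolding dual_def[abs_def] by (rule measurable_epowr) (rule w_measurable)

lemma pulled_measurable [measurable]: "pulled \<in> borel_measurable lebesgue"
  unfolding pulled_def[abs_def]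
  by (intro measurable_epowr measurable_compose[OF measurable_matrix_lebesgue[OF A]] w_measurable)

lemma conj_exponent_pos: "conj_exponent p > 0"
  using p by (simp add: conj_exponent_def)

text \<open>This identity gives \<sigma>^p * w^p = \<sigma> wherever w is neither 0 nor
  \<infinity>.\<close>

lemma conj_exponent_mult: "conj_exponent p * p = conj_exponent p + p"
  using p by (simp add: conj_exponent_def field_simps)

text \<open>Substituting \<open>A *v x\<close> cancels the inverse matrix in the maximal function
  and turns w^q into \<open>pulled\<close>.\<close>

lemma maximal_change_of_variables:
  "(\<integral>\<^sup>+x. epowr (frac_maximal_mat \<alpha> (matrix_inv A) g x) q * epowr (w x) q \<partial>lebesgue)
    = ennreal \<bar>det A\<bar> * (\<integral>\<^sup>+x. epowr (frac_maximal \<alpha> g x) q * pulled x \<partial>lebesgue)"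
proof -
  have inv: "matrix_inv A *v (A *v x) = x" for x
    using matrix_inv_inverse[OF A] by (simp add: matrix_vector_mul_assoc)
  have Ai: "invertible (matrix_inv A)"
    unfolding invertible_def using matrix_inv_inverse[OF A] by blast
  have "frac_maximal \<alpha> g \<in> borel_measurable lebesgue"
    by (intro measurable_completion) (simp add: borel_measurable_frac_maximal)
  then have "(\<lambda>x. frac_maximal_mat \<alpha> (matrix_inv A) g x) \<in> borel_measurable lebesgue"
    unfolding frac_maximal_mat_def by (rule measurable_compose[OF measurable_matrix_lebesgue[OF Ai]])
  then have "(\<lambda>x. epowr (frac_maximal_mat \<alpha> (matrix_inv A) g x) q * epowr (w x) q) \<in> borel_measurable lebesgue"
    by (intro borel_measurable_times_ennreal measurable_epowr w_measurable)
  then show ?thesis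
    by (subst nn_integral_matrix[OF A]) (simp_all add: frac_maximal_mat_def inv pulled_def)
qed

lemma weighted_norm_identity:
  assumes "AE x in lebesgue. w x \<noteq> 0" and t: "\<And>x. t x \<ge> 0"
  shows "(\<integral>\<^sup>+x. epowr (ennreal (t x) * dual x) p * epowr (w x) p \<partial>lebesgue)
    = (\<integral>\<^sup>+x. ennreal (t x powr p) * dual x \<partial>lebesgue)"
proof (rule nn_integral_cong_AE)
  show "AE x in lebesgue. epowr (ennreal (t x) * dual x) p * epowr (w x) p = ennreal (t x powr p) * dual x"
    using assms(1) weight_AE_finite[OF w]
  proof eventually_elim
    case (elim x)
    have "epowr (dual x) p * epowr (w x) p = epowr (w x) (- conj_exponent p * p + p)"
      by (simp only: dual_def epowr_epowr epowr_add[OF elim])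
    also have "- conj_exponent p * p + p = - conj_exponent p"
      using conj_exponent_mult by simp
    finally have "epowr (dual x) p * epowr (w x) p = dual x" by (simp add: dual_def)
    then show ?case
      using p t[of x] by (simp add: epowr_mult epowr_ennreal_nonneg mult.assoc)
  qed
qed

text \<open>Sawyer's form of the inequality. Positivity of \<open>w\<close> almost everywhere is
  required to simplify the right-hand norm.\<close>

lemma maximal_ineq_iff:
  assumes "AE x in lebesgue. w x \<noteq> 0"
  shows "maximal_ineq \<alpha> A p q w c \<longleftrightarrow> (\<forall>f :: real ^ 'n \<Rightarrow> real. f \<in> borel_measurable lebesgue \<longrightarrow>
    (\<integral>\<^sup>+x. ennreal (\<bar>f x\<bar> powr p) * dual x \<partial>lebesgue) \<noteq> top \<longrightarrow>
    ennreal (\<bar>det A\<bar> powr (1 / q)) *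
      epowr (\<integral>\<^sup>+x. epowr (frac_maximal \<alpha> (\<lambda>y. ennreal \<bar>f y\<bar> * dual y) x) q * pulled x \<partial>lebesgue) (1 / q)
    \<le> c * epowr (\<integral>\<^sup>+x. ennreal (\<bar>f x\<bar> powr p) * dual x \<partial>lebesgue) (1 / p))"
proof -
  have "epowr (ennreal \<bar>det A\<bar> * X) (1 / q) = ennreal (\<bar>det A\<bar> powr (1 / q)) * epowr X (1 / q)" for X
    using A p pq by (simp add: epowr_mult epowr_ennreal_nonneg)
  then show ?thesis
    unfolding maximal_ineq_def Let_def dual_def[symmetric] maximal_change_of_variables
    using weighted_norm_identity[OF assms, of "\<lambda>x. \<bar>f x\<bar>" for f] by (simp add: less_top)
qed

lemma mat_class_iff:
  "w \<in> mat_class \<alpha> A p q \<longleftrightarrow> weight pulled \<and> weight dual \<and> mat_const \<alpha> A p q w \<noteq> top"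
  by (simp add: mat_class_def testing_class_def mat_const_def pulled_def[abs_def] dual_def[abs_def] less_top)

lemma mat_const_eq:
  "mat_const \<alpha> A p q w = (SUP Q\<in>cubes. epowr (\<integral>\<^sup>+x\<in>Q. dual x \<partial>lebesgue) (- (1 / p)) *
    epowr (\<integral>\<^sup>+x\<in>Q. epowr (frac_maximal \<alpha> (\<lambda>y. indicator Q y * dual y) x) q * pulled x \<partial>lebesgue) (1 / q))"
  by (simp add: mat_const_def testing_const_def pulled_def dual_def)

text \<open>The negative power is \<infinity> where \<open>w\<close> vanishes, and a locally
  integrable function is finite almost everywhere.\<close>

lemma AE_pos_of_weight_dual:
  assumes "weight dual"
  shows "AE x in lebesgue. w x \<noteq> 0"
  using weight_AE_finite[OF assms]
  by eventually_elim (use conj_exponent_pos in \<open>auto simp: dual_def\<close>)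

lemma dual_AE_pos: "AE x in lebesgue. dual x \<noteq> 0"
  using weight_AE_finite[OF w]
proof eventually_elim
  case (elim x)
  then show ?case
    using conj_exponent_pos by (cases "w x" rule: ennreal_cases_pos) (auto simp: dual_def epowr_ennreal)
qed

text \<open>The quotient in the testing constant can be multiplied out because \<sigma>(Q) is
  neither 0 nor \<infinity>; an infinite value would make its term 0 by convention and lose all
  information.\<close>

lemma testing_of_mat_const:
  assumes T: "mat_const \<alpha> A p q w \<noteq> top" and dual: "weight dual" and Q: "Q \<in> cubes"
  shows "(\<integral>\<^sup>+x\<in>Q. epowr (frac_maximal \<alpha> (\<lambda>y. indicator Q y * dual y) x) q * pulled x \<partial>lebesgue)
    \<le> epowr (mat_const \<alpha> A p q w) q * epowr (\<integral>\<^sup>+x\<in>Q. dual x \<partial>lebesgue) (q / p)"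
    (is "?X \<le> _ * epowr ?s _")
proof -
  have q: "q > 0" using p pq by simp
  have s: "?s \<noteq> top" "?s \<noteq> 0"
    using dual Q unfolding weight_iff_cubes by (blast, intro nn_integral_cube_pos[OF Q dual_measurable dual_AE_pos])
  have "epowr ?s (- (1 / p)) * epowr ?X (1 / q) \<le> mat_const \<alpha> A p q w"
    unfolding mat_const_eq using Q by (rule SUP_upper)
  then have "epowr ?s (- (1 / p)) * epowr ?X (1 / q) * epowr ?s (1 / p) \<le> mat_const \<alpha> A p q w * epowr ?s (1 / p)"
    by (rule mult_right_mono) simp
  moreover have "epowr ?s (- (1 / p)) * epowr ?X (1 / q) * epowr ?s (1 / p) = epowr ?X (1 / q)"
  proof -
    have "a * y * b = (a * b) * y" for a b y :: ennreal by (simp only: mult_ac)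
    then show ?thesis by (simp only: epowr_uminus_mult_cancel[OF s(2,1)] mult_1_left)
  qed
  ultimately have "epowr ?X (1 / q) \<le> mat_const \<alpha> A p q w * epowr ?s (1 / p)" by simp
  then have "?X \<le> epowr (mat_const \<alpha> A p q w * epowr ?s (1 / p)) q"
    using q by (subst (asm) epowr_le_iff) simp_all
  then show ?thesis using q by (simp add: epowr_mult epowr_epowr)
qed

text \<open>Sawyer's bound has the \<open>q\<close>-th power of the testing constant as its factor,
  so the \<open>q\<close>-th root is linear in that constant. The determinant stems from the change
  of variables.\<close>

lemma maximal_ineq_of_mat_class:
  assumes "w \<in> mat_class \<alpha> A p q"
  shows "maximal_ineq \<alpha> A p q w (ennreal (sawyer_cube_const TYPE('n) (1 - \<alpha> / real CARD('n)) p q powr (1 / q)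
    * \<bar>det A\<bar> powr (1 / q)) * mat_const \<alpha> A p q w)"
proof -
  have q: "q > 0" using p pq by simp
  have dual: "weight dual" and T: "mat_const \<alpha> A p q w \<noteq> top"
    using assms by (simp_all add: mat_class_iff)
  define C where "C = sawyer_cube_const TYPE('n) (1 - \<alpha> / real CARD('n)) p q"
  have C: "C > 0" unfolding C_def by (rule sawyer_cube_const_pos[OF p])
  show ?thesis
    unfolding maximal_ineq_iff[OF AE_pos_of_weight_dual[OF dual]] C_def[symmetric]
  proof (intro allI impI)
    fix f :: "real ^ 'n \<Rightarrow> real"
    assume f: "f \<in> borel_measurable lebesgue"
      and N: "(\<integral>\<^sup>+x. ennreal (\<bar>f x\<bar> powr p) * dual x \<partial>lebesgue) \<noteq> top" (is "?N \<noteq> _")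
    let ?L = "\<integral>\<^sup>+x. epowr (frac_maximal \<alpha> (\<lambda>y. ennreal \<bar>f y\<bar> * dual y) x) q * pulled x \<partial>lebesgue"
    have "?L \<le> ennreal C * epowr (mat_const \<alpha> A p q w) q * epowr ?N (q / p)"
      unfolding C_def
    proof (rule sawyer_cubes[OF \<alpha> p pq dual_measurable pulled_measurable _ _ _ _ N])
      show "(\<lambda>x. \<bar>f x\<bar>) \<in> borel_measurable lebesgue" using f by (rule borel_measurable_abs)
      show "(\<integral>\<^sup>+x\<in>Q. dual x \<partial>lebesgue) \<noteq> top" if "Q \<in> cubes" for Q
        using dual that by (simp add: weight_iff_cubes)
    qed (use testing_of_mat_const[OF T dual] in simp_all)
    then have "epowr ?L (1 / q) \<le> epowr (ennreal C * epowr (mat_const \<alpha> A p q w) q * epowr ?N (q / p)) (1 / q)"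
      using q by (intro epowr_mono) auto
    also have "\<dots> = ennreal (C powr (1 / q)) * mat_const \<alpha> A p q w * epowr ?N (1 / p)"
      using q C by (simp add: epowr_mult epowr_epowr epowr_ennreal)
    finally have "ennreal (\<bar>det A\<bar> powr (1 / q)) * epowr ?L (1 / q) \<le>
        ennreal (\<bar>det A\<bar> powr (1 / q)) * (ennreal (C powr (1 / q)) * mat_const \<alpha> A p q w * epowr ?N (1 / p))"
      by (rule mult_left_mono) simp
    also have "\<dots> = ennreal (C powr (1 / q) * \<bar>det A\<bar> powr (1 / q)) * mat_const \<alpha> A p q w * epowr ?N (1 / p)"
      by (simp only: ennreal_mult[OF powr_ge_zero powr_ge_zero] mult_ac)
    finally show "ennreal (\<bar>det A\<bar> powr (1 / q)) * epowr ?L (1 / q) \<le>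
      ennreal (C powr (1 / q) * \<bar>det A\<bar> powr (1 / q)) * mat_const \<alpha> A p q w * epowr ?N (1 / p)" .
  qed
qed

section \<open>From the inequality to the testing class\<close>

text \<open>Take f to be the indicator of the zero set \<open>E\<close>. Then g is \<infinity> on
  \<open>E\<close>, yet the right side is 0 since w^p vanishes there. If \<open>E\<close> had
  positive measure, the maximal function would be \<infinity> everywhere and force w = 0 almost
  everywhere.\<close>

lemma AE_pos_of_maximal_ineq:
  assumes ineq: "maximal_ineq \<alpha> A p q w c" and nz: "\<not> (AE x in lebesgue. w x = 0)"
  shows "AE x in lebesgue. w x \<noteq> 0"
proof (rule ccontr)
  assume neg: "\<not> (AE x in lebesgue. w x \<noteq> 0)"
  have q: "q > 0" using p pq by simp
  define E where "E = {x. w x = 0}"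
  have E [measurable]: "E \<in> sets lebesgue"
    using measurable_sets[OF w_measurable, of "{0}"] by (simp add: E_def vimage_def)
  define g where "g = (\<lambda>x. ennreal \<bar>indicator E x\<bar> * epowr (w x) (- conj_exponent p))"
  have g: "g x = top * indicator E x" for x
    using conj_exponent_pos by (auto simp: g_def E_def split: split_indicator)
  have g_eq: "ennreal \<bar>indicator E x\<bar> * epowr (w x) (- conj_exponent p) = g x" for x
    by (simp add: g_def)
  have zero: "epowr (g x) p * epowr (w x) p = 0" for x
    using p by (auto simp: g E_def split: split_indicator)
  \<comment> \<open>A large enough ball around \<open>x\<close> meets \<open>E\<close> in positive
    measure, and a cube containing that ball has an infinite average.\<close>
  have Mtop: "frac_maximal \<alpha> g x = top" for x
  proof -
    have ex: "\<exists>k. emeasure lebesgue (E \<inter> cball x (real k)) \<noteq> 0"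
    proof (rule ccontr)
      assume "\<nexists>k. emeasure lebesgue (E \<inter> cball x (real k)) \<noteq> 0"
      then have "E \<inter> cball x (real k) \<in> null_sets lebesgue" for k
        by (intro null_setsI) (auto intro!: sets.Int)
      then have "(\<Union>k. E \<inter> cball x (real k)) \<in> null_sets lebesgue" by (intro null_sets_UN)
      moreover have "(\<Union>k. E \<inter> cball x (real k)) = E"
        using real_arch_simple by (auto simp: mem_cball)
      ultimately have "E \<in> null_sets lebesgue" by simp
      then have "AE x in lebesgue. w x \<noteq> 0"
        by (rule AE_not_in[THEN eventually_mono]) (simp add: E_def)
      then show False using neg by simp
    qed
    then obtain k where k: "emeasure lebesgue (E \<inter> cball x (real k)) \<noteq> 0" by blast
    obtain Q where Q: "Q \<in> cubes" "cball x (real k) \<subseteq> Q"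
      by (rule compact_subset_cube[OF compact_cball])
    have Qm [measurable]: "Q \<in> sets lebesgue" by (rule cubes_lebesgue[OF Q(1)])
    have xQ: "x \<in> Q" using Q(2) by auto
    have "emeasure lebesgue (E \<inter> cball x (real k)) \<le> emeasure lebesgue (E \<inter> Q)"
      using Q(2) by (intro emeasure_mono) auto
    then have pos: "emeasure lebesgue (E \<inter> Q) \<noteq> 0" using k by auto
    have "(\<integral>\<^sup>+y\<in>Q. g y \<partial>lebesgue) = (\<integral>\<^sup>+y. top * indicator (E \<inter> Q) y \<partial>lebesgue)"
      by (intro nn_integral_cong) (auto simp: g split: split_indicator)
    also have "\<dots> = top * emeasure lebesgue (E \<inter> Q)"
      by (intro nn_integral_cmult_indicator sets.Int E Qm)
    also have "\<dots> = top" using pos by (simp add: ennreal_top_mult)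
    finally have "(\<integral>\<^sup>+y\<in>Q. g y \<partial>lebesgue) = top" .
    moreover have "epowr (emeasure lebesgue Q) (1 - \<alpha> / real CARD('n)) \<noteq> top"
      using cube_emeasure_pos_finite[OF Q(1)] \<alpha> by (subst epowr_eq_top_iff) auto
    ultimately show ?thesis
      using frac_maximal_ge[OF Q(1) xQ, where h = g and \<alpha> = \<alpha>] by (simp add: ennreal_top_divide top_unique)
  qed
  have "epowr (\<integral>\<^sup>+x. epowr (frac_maximal_mat \<alpha> (matrix_inv A) g x) q * epowr (w x) q \<partial>lebesgue) (1 / q)
    \<le> c * epowr (\<integral>\<^sup>+x. epowr (g x) p * epowr (w x) p \<partial>lebesgue) (1 / p)"
    by (rule ineq[unfolded maximal_ineq_def Let_def, rule_format, of "indicator E", unfolded g_eq,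
          OF borel_measurable_indicator[OF E]]) (simp add: zero)
  then have "(\<integral>\<^sup>+x. top * epowr (w x) q \<partial>lebesgue) = 0"
    using p q by (simp add: zero frac_maximal_mat_def Mtop epowr_eq_0_iff)
  then have "AE x in lebesgue. top * epowr (w x) q = 0"
    by (subst (asm) nn_integral_0_iff_AE) (intro borel_measurable_times_ennreal borel_measurable_const measurable_epowr w_measurable)
  then have "AE x in lebesgue. w x = 0"
    by eventually_elim (use q in \<open>auto simp: epowr_eq_0_iff\<close>)
  then show False using nz by simp
qed

lemma indicator_test:
  assumes pos: "AE x in lebesgue. w x \<noteq> 0" and ineq: "maximal_ineq \<alpha> A p q w c"
    and S: "S \<in> sets lebesgue" and fin: "(\<integral>\<^sup>+x\<in>S. dual x \<partial>lebesgue) \<noteq> top"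
  shows "ennreal (\<bar>det A\<bar> powr (1 / q)) *
      epowr (\<integral>\<^sup>+x. epowr (frac_maximal \<alpha> (\<lambda>y. indicator S y * dual y) x) q * pulled x \<partial>lebesgue) (1 / q)
    \<le> c * epowr (\<integral>\<^sup>+x\<in>S. dual x \<partial>lebesgue) (1 / p)"
proof -
  have 1: "ennreal \<bar>indicator S y\<bar> * dual y = indicator S y * dual y" for y
    by (simp split: split_indicator)
  have 2: "(\<integral>\<^sup>+x. ennreal (\<bar>indicator S x\<bar> powr p) * dual x \<partial>lebesgue) = (\<integral>\<^sup>+x\<in>S. dual x \<partial>lebesgue)"
    using p by (intro nn_integral_cong) (simp split: split_indicator)
  have "(indicator S :: _ \<Rightarrow> real) \<in> borel_measurable lebesgue" using S by (rule borel_measurable_indicator)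
  then show ?thesis
    using ineq[unfolded maximal_ineq_iff[OF pos], rule_format, of "indicator S"] fin unfolding 1 2 by blast
qed

text \<open>On all of \<open>Q\<close> the maximal function of the test function is at least the
  average over \<open>Q\<close>, so the integral of \<open>pulled\<close> over \<open>Q\<close> is
  controlled as well.\<close>

lemma average_test:
  assumes pos: "AE x in lebesgue. w x \<noteq> 0" and ineq: "maximal_ineq \<alpha> A p q w c"
    and S: "S \<in> sets lebesgue" and fin: "(\<integral>\<^sup>+x\<in>S. dual x \<partial>lebesgue) \<noteq> top"
    and Q: "Q \<in> cubes" "S \<subseteq> Q"
  shows "ennreal (\<bar>det A\<bar> powr (1 / q)) * ((\<integral>\<^sup>+x\<in>S. dual x \<partial>lebesgue) /
      epowr (emeasure lebesgue Q) (1 - \<alpha> / real CARD('n)) * epowr (\<integral>\<^sup>+x\<in>Q. pulled x \<partial>lebesgue) (1 / q))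
    \<le> c * epowr (\<integral>\<^sup>+x\<in>S. dual x \<partial>lebesgue) (1 / p)"
proof -
  have q: "q > 0" using p pq by simp
  define t where "t = (\<integral>\<^sup>+x\<in>S. dual x \<partial>lebesgue) / epowr (emeasure lebesgue Q) (1 - \<alpha> / real CARD('n))"
  have "(\<integral>\<^sup>+y\<in>Q. indicator S y * dual y \<partial>lebesgue) = (\<integral>\<^sup>+x\<in>S. dual x \<partial>lebesgue)"
    using Q(2) by (intro nn_integral_cong) (auto split: split_indicator)
  then have t_le: "t \<le> frac_maximal \<alpha> (\<lambda>y. indicator S y * dual y) x" if "x \<in> Q" for x
    using frac_maximal_ge[OF Q(1) that, of "\<lambda>y. indicator S y * dual y" \<alpha>] unfolding t_def by simp
  have "epowr t q * (\<integral>\<^sup>+x\<in>Q. pulled x \<partial>lebesgue) = (\<integral>\<^sup>+x. epowr t q * (pulled x * indicator Q x) \<partial>lebesgue)"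
    by (intro nn_integral_cmult[symmetric] borel_measurable_times_ennreal pulled_measurable
        borel_measurable_indicator cubes_lebesgue Q)
  also have "\<dots> \<le> (\<integral>\<^sup>+x. epowr (frac_maximal \<alpha> (\<lambda>y. indicator S y * dual y) x) q * pulled x \<partial>lebesgue)"
  proof (rule nn_integral_mono)
    fix x
    show "epowr t q * (pulled x * indicator Q x) \<le> epowr (frac_maximal \<alpha> (\<lambda>y. indicator S y * dual y) x) q * pulled x"
    proof (cases "x \<in> Q")
      case True
      then have "epowr t q \<le> epowr (frac_maximal \<alpha> (\<lambda>y. indicator S y * dual y) x) q"
        using q by (intro epowr_mono t_le) auto
      then show ?thesis using True by (simp add: mult_right_mono)
    qed simp
  qed
  finally have "epowr (epowr t q * (\<integral>\<^sup>+x\<in>Q. pulled x \<partial>lebesgue)) (1 / q) \<le>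
      epowr (\<integral>\<^sup>+x. epowr (frac_maximal \<alpha> (\<lambda>y. indicator S y * dual y) x) q * pulled x \<partial>lebesgue) (1 / q)"
    using q by (intro epowr_mono) auto
  also have "epowr (epowr t q * (\<integral>\<^sup>+x\<in>Q. pulled x \<partial>lebesgue)) (1 / q) = t * epowr (\<integral>\<^sup>+x\<in>Q. pulled x \<partial>lebesgue) (1 / q)"
    using q by (simp add: epowr_mult epowr_epowr)
  finally show ?thesis
    unfolding t_def[symmetric]
    by (rule order_trans[OF mult_left_mono indicator_test[OF pos ineq S fin]]) simp
qed

lemma pulled_AE_pos:
  assumes "AE x in lebesgue. w x \<noteq> 0"
  shows "AE x in lebesgue. pulled x \<noteq> 0"
  using AE_matrix[OF A assms] by eventually_elim (use p pq in \<open>simp add: pulled_def epowr_eq_0_iff\<close>)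

text \<open>Local integrability of \<open>dual\<close> is not yet known at this stage; since
  \<open>dual\<close> is finite almost everywhere, its truncations exhaust the integral by monotone
  convergence.\<close>

lemma truncated_dual_SUP:
  assumes pos: "AE x in lebesgue. w x \<noteq> 0" and Q: "Q \<in> cubes"
  shows "(\<integral>\<^sup>+x\<in>Q. dual x \<partial>lebesgue) \<le> (SUP k. \<integral>\<^sup>+x\<in>Q \<inter> {x. dual x \<le> of_nat k}. dual x \<partial>lebesgue)"
proof -
  define f where "f k x = dual x * indicator (Q \<inter> {x. dual x \<le> of_nat k}) x" for k :: nat and x
  have [measurable]: "Q \<in> sets lebesgue" by (rule cubes_lebesgue[OF Q])
  have "(\<integral>\<^sup>+x\<in>Q. dual x \<partial>lebesgue) \<le> (\<integral>\<^sup>+x. (SUP k. f k x) \<partial>lebesgue)"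
  proof (rule nn_integral_mono_AE)
    show "AE x in lebesgue. dual x * indicator Q x \<le> (SUP k. f k x)"
      using pos
    proof eventually_elim
      case (elim x)
      then have "dual x < top"
        using conj_exponent_pos by (cases "w x" rule: ennreal_cases_pos) (auto simp: dual_def epowr_ennreal)
      then obtain r k where "dual x = ennreal r" "r \<le> real k"
        by (metis ennreal_cases less_irrefl real_arch_simple)
      then have "dual x \<le> of_nat k" by (simp add: ennreal_of_nat_eq_real_of_nat ennreal_leI)
      then have "dual x * indicator Q x = f k x" by (simp add: f_def split: split_indicator)
      also have "\<dots> \<le> (SUP k. f k x)" by (rule SUP_upper) simp
      finally show ?case .
    qed
  qed
  also have "\<dots> = (SUP k. \<integral>\<^sup>+x. f k x \<partial>lebesgue)"
  proof (rule nn_integral_monotone_convergence_SUP)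
    have "dual x \<le> of_nat (Suc k)" if "dual x \<le> of_nat k" for x k
      using that by (rule order_trans) simp
    then show "incseq f"
      by (intro incseq_SucI le_funI) (auto simp: f_def split: split_indicator)
    show "f k \<in> borel_measurable lebesgue" for k
      unfolding f_def[abs_def] by measurable
  qed
  finally show ?thesis by (simp add: f_def)
qed

text \<open>The indicator of \<open>Q\<close> is not yet admissible, as \<sigma>(Q) might be
  infinite; the truncated sets \<open>S k\<close> are. A single nonzero \<open>s k\<close> bounds
  u(Q), and the uniform bound on all \<open>s k\<close> bounds \<sigma>(Q).\<close>

lemma cube_integrals_finite:
  assumes pos: "AE x in lebesgue. w x \<noteq> 0" and ineq: "maximal_ineq \<alpha> A p q w c" and c: "c \<noteq> top"
    and Q: "Q \<in> cubes"
  shows "(\<integral>\<^sup>+x\<in>Q. pulled x \<partial>lebesgue) \<noteq> top" "(\<integral>\<^sup>+x\<in>Q. dual x \<partial>lebesgue) \<noteq> top"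
proof -
  have q: "q > 0" "1 / q > 0" using p pq by auto
  have p1: "1 - 1 / p > 0" using p by simp
  define S where "S k = Q \<inter> {x. dual x \<le> of_nat k}" for k :: nat
  define s where "s k = (\<integral>\<^sup>+x\<in>S k. dual x \<partial>lebesgue)" for k
  define U where "U = (\<integral>\<^sup>+x\<in>Q. pulled x \<partial>lebesgue)"
  define b where "b = epowr (emeasure lebesgue Q) (1 - \<alpha> / real CARD('n))"
  define d where "d = ennreal (\<bar>det A\<bar> powr (1 / q))"
  \<comment> \<open>The factor of \<open>s k\<close> in \<open>average_test\<close>; it is infinite
    when u(Q) is.\<close>
  define V where "V = d * inverse b * epowr U (1 / q)"
  have [measurable]: "Q \<in> sets lebesgue" by (rule cubes_lebesgue[OF Q])
  have Sm: "S k \<in> sets lebesgue" for k unfolding S_def by measurable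
  have b: "b \<noteq> 0" "b \<noteq> top"
    using cube_emeasure_pos_finite[OF Q] \<alpha> by (auto simp: b_def epowr_eq_0_iff epowr_eq_top_iff)
  have d: "d \<noteq> 0" "d \<noteq> top" using A by (auto simp: d_def invertible_det_nz)
  have "U \<noteq> 0"
    unfolding U_def by (rule nn_integral_cube_pos[OF Q pulled_measurable pulled_AE_pos[OF pos]])
  then have V0: "V \<noteq> 0" using b d q by (simp add: V_def epowr_eq_0_iff)
  have Vtop: "V = top" if "U = top"
    using that b d q by (simp add: V_def ennreal_mult_top)
  have sfin: "s k \<noteq> top" for k
  proof -
    have "s k \<le> (\<integral>\<^sup>+x. of_nat k * indicator Q x \<partial>lebesgue)"
      unfolding s_def S_def by (intro nn_integral_mono) (auto split: split_indicator)
    also have "\<dots> = of_nat k * emeasure lebesgue Q" by (rule nn_integral_cmult_indicator) measurable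
    also have "\<dots> < top" using cube_emeasure_pos_finite(2)[OF Q] by (simp add: ennreal_mult_less_top less_top ennreal_of_nat_eq_real_of_nat)
    finally show ?thesis by simp
  qed
  \<comment> \<open>Dividing by \<open>s k\<close> to the power 1/p leaves the exponent 1 - 1/p,
    positive because \<open>p > 1\<close>; this allows solving for \<open>s k\<close>.\<close>
  have key: "V * epowr (s k) (1 - 1 / p) \<le> c" if "s k \<noteq> 0" for k
  proof -
    have "d * (s k / b * epowr U (1 / q)) \<le> c * epowr (s k) (1 / p)"
      using average_test[OF pos ineq Sm[of k] _ Q] sfin[of k]
      unfolding s_def b_def U_def d_def S_def by blast
    then have "V * s k \<le> c * epowr (s k) (1 / p)"
      by (simp only: V_def divide_ennreal_def mult_ac)
    then have "V * s k * epowr (s k) (- (1 / p)) \<le> c * epowr (s k) (1 / p) * epowr (s k) (- (1 / p))"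
      by (rule mult_right_mono) simp
    moreover have "s k * epowr (s k) (- (1 / p)) = epowr (s k) (1 - 1 / p)"
      using epowr_add[OF that sfin, of 1 "- (1 / p)"] by simp
    moreover have "epowr (s k) (1 / p) * epowr (s k) (- (1 / p)) = 1"
      using epowr_uminus_mult_cancel[OF that sfin, of "1 / p"] by (simp only: mult.commute)
    ultimately show ?thesis by (simp only: mult.assoc mult_1_right)
  qed
  have SUP_s: "(\<integral>\<^sup>+x\<in>Q. dual x \<partial>lebesgue) \<le> (SUP k. s k)"
    unfolding s_def S_def by (rule truncated_dual_SUP[OF pos Q])
  have "\<exists>k. s k \<noteq> 0"
  proof (rule ccontr)
    assume "\<nexists>k. s k \<noteq> 0"
    then have "(\<integral>\<^sup>+x\<in>Q. dual x \<partial>lebesgue) = 0" using SUP_s by simp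
    then show False using nn_integral_cube_pos[OF Q dual_measurable dual_AE_pos] by simp
  qed
  then obtain k where k: "s k \<noteq> 0" by blast
  have "V \<noteq> top"
  proof
    assume "V = top"
    moreover have "epowr (s k) (1 - 1 / p) \<noteq> 0" using k p1 by (simp only: epowr_eq_0_iff not_False_eq_True)
    ultimately have "V * epowr (s k) (1 - 1 / p) = top" by (simp add: ennreal_top_mult)
    then show False using key[OF k] c by (simp add: top_unique)
  qed
  then show "(\<integral>\<^sup>+x\<in>Q. pulled x \<partial>lebesgue) \<noteq> top" using Vtop by (auto simp: U_def)
  obtain v where v: "v > 0" "V = ennreal v" using V0 \<open>V \<noteq> top\<close> by (metis ennreal_cases_pos)
  define B where "B = epowr (ennreal (1 / v) * c) (1 / (1 - 1 / p))"
  have "s k \<le> B" for k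
  proof (cases "s k = 0")
    case False
    have "ennreal (1 / v) * (V * epowr (s k) (1 - 1 / p)) \<le> ennreal (1 / v) * c"
      by (rule mult_left_mono[OF key[OF False]]) simp
    moreover have "ennreal (1 / v) * V = 1" using v by (simp flip: ennreal_mult)
    ultimately have "epowr (s k) (1 - 1 / p) \<le> ennreal (1 / v) * c"
      by (simp only: mult.assoc[symmetric] mult_1_left)
    then show ?thesis unfolding B_def by (simp only: epowr_le_iff[OF p1])
  qed simp
  then have "(SUP k. s k) \<le> B" by (rule SUP_least)
  moreover have "ennreal (1 / v) * c \<noteq> top" using c by (simp add: ennreal_mult_eq_top_iff)
  then have "B \<noteq> top" using p1 unfolding B_def by (subst epowr_eq_top_iff) simp_all
  ultimately show "(\<integral>\<^sup>+x\<in>Q. dual x \<partial>lebesgue) \<noteq> top" using SUP_s by (metis order_trans top_unique)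
qed

text \<open>Once \<sigma>(Q) is finite, the indicator of \<open>Q\<close> is admissible. Restricting
  the left integral to \<open>Q\<close> and dividing by \<sigma>(Q)^(1/p) gives each term of the
  testing constant.\<close>

lemma mat_class_of_maximal_ineq:
  assumes ineq: "maximal_ineq \<alpha> A p q w c" and c: "c \<noteq> top" and nz: "\<not> (AE x in lebesgue. w x = 0)"
  shows "w \<in> mat_class \<alpha> A p q"
proof -
  have q: "q > 0" "1 / q > 0" using p pq by auto
  have pos: "AE x in lebesgue. w x \<noteq> 0" by (rule AE_pos_of_maximal_ineq[OF ineq nz])
  have "weight pulled" "weight dual"
    using cube_integrals_finite[OF pos ineq c] pulled_measurable dual_measurable
    by (simp_all add: weight_iff_cubes)
  moreover have "mat_const \<alpha> A p q w \<le> c * ennreal (1 / \<bar>det A\<bar> powr (1 / q))"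
    unfolding mat_const_eq
  proof (rule SUP_least)
    fix Q :: "(real ^ 'n) set" assume Q: "Q \<in> cubes"
    define s where "s = (\<integral>\<^sup>+x\<in>Q. dual x \<partial>lebesgue)"
    define d where "d = \<bar>det A\<bar> powr (1 / q)"
    have d: "d > 0" using A by (simp add: d_def invertible_det_nz)
    let ?g = "\<lambda>x. epowr (frac_maximal \<alpha> (\<lambda>y. indicator Q y * dual y) x) q * pulled x"
    define Y where "Y = epowr (\<integral>\<^sup>+x\<in>Q. ?g x \<partial>lebesgue) (1 / q)"
    have s: "s \<noteq> 0" "s \<noteq> top"
      unfolding s_def using nn_integral_cube_pos[OF Q dual_measurable dual_AE_pos] cube_integrals_finite(2)[OF pos ineq c Q]
      by blast+
    have "(\<integral>\<^sup>+x\<in>Q. ?g x \<partial>lebesgue) \<le> (\<integral>\<^sup>+x. ?g x \<partial>lebesgue)"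
      by (intro nn_integral_mono) (simp split: split_indicator)
    then have "ennreal d * Y \<le> ennreal d * epowr (\<integral>\<^sup>+x. ?g x \<partial>lebesgue) (1 / q)"
      unfolding Y_def using q by (intro mult_left_mono epowr_mono) auto
    also have "\<dots> \<le> c * epowr s (1 / p)"
      unfolding s_def d_def
      by (rule indicator_test[OF pos ineq cubes_lebesgue[OF Q] cube_integrals_finite(2)[OF pos ineq c Q]])
    finally have "(epowr s (- (1 / p)) * ennreal (1 / d)) * (ennreal d * Y) \<le>
        (epowr s (- (1 / p)) * ennreal (1 / d)) * (c * epowr s (1 / p))"
      by (rule mult_left_mono) simp
    moreover have swap: "(a * x) * (y * z) = (x * y) * (a * z)" "(a * x) * (y * z) = (a * z) * (y * x)"
      for a x y z :: ennreal
      by (simp_all only: mult_ac)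
    have one: "ennreal (1 / d) * ennreal d = 1" using d by (simp flip: ennreal_mult)
    have "(epowr s (- (1 / p)) * ennreal (1 / d)) * (ennreal d * Y) = epowr s (- (1 / p)) * Y"
      by (subst swap(1)) (simp only: one mult_1_left)
    moreover have "(epowr s (- (1 / p)) * ennreal (1 / d)) * (c * epowr s (1 / p)) = c * ennreal (1 / d)"
      by (subst swap(2)) (simp only: epowr_uminus_mult_cancel[OF s] mult_1_left)
    ultimately have "epowr s (- (1 / p)) * Y \<le> c * ennreal (1 / d)" by simp
    then show "epowr (\<integral>\<^sup>+x\<in>Q. dual x \<partial>lebesgue) (- (1 / p)) * epowr (\<integral>\<^sup>+x\<in>Q. ?g x \<partial>lebesgue) (1 / q)
        \<le> c * ennreal (1 / \<bar>det A\<bar> powr (1 / q))"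
      by (simp only: s_def Y_def d_def)
  qed
  then have "mat_const \<alpha> A p q w \<noteq> top"
    using c by (auto simp: top_unique ennreal_mult_eq_top_iff)
  ultimately show ?thesis by (simp only: mat_class_iff simp_thms)
qed

end

text \<open>\<open>C\<close> is chosen before \<open>A\<close> and \<open>w\<close>. The determinant
  cannot be absorbed into it: for w = 1 and multiples of the identity the testing constant is fixed
  while the left side scales. If w = 0 almost everywhere, the inequality is trivial although w^(-p')
  is not a weight.\<close>

theorem corollary1p6:
  fixes \<alpha> p q :: real
  assumes "0 \<le> \<alpha>" and "\<alpha> < real CARD('n::finite)"
    and "1 < p" and "\<alpha> > 0 \<Longrightarrow> p < real CARD('n) / \<alpha>"
    and "1 / q = 1 / p - \<alpha> / real CARD('n)"
  shows "\<exists>C>0. \<forall>(A :: real ^ 'n ^ 'n) (w :: real ^ 'n \<Rightarrow> ennreal).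
    invertible A \<longrightarrow> weight w \<longrightarrow> \<not> (AE x in lebesgue. w x = 0) \<longrightarrow>
      (w \<in> mat_class \<alpha> A p q \<longleftrightarrow> (\<exists>K::real. maximal_ineq \<alpha> A p q w (ennreal K))) \<and>
      (w \<in> mat_class \<alpha> A p q \<longleftrightarrow>
         mat_const \<alpha> A p q w < \<infinity> \<and>
         maximal_ineq \<alpha> A p q w
           (ennreal (C * \<bar>det A\<bar> powr (1 / q)) * mat_const \<alpha> A p q w))"
proof -
  define C where "C = sawyer_cube_const TYPE('n) (1 - \<alpha> / real CARD('n)) p q powr (1 / q)"
  have pq: "p \<le> q" using assms by (rule exponent_bounds)
  have "C > 0" using sawyer_cube_const_pos[OF assms(3), where 'n = 'n] by (simp add: C_def less_imp_neq[symmetric])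
  moreover have "(w \<in> mat_class \<alpha> A p q \<longleftrightarrow> (\<exists>K::real. maximal_ineq \<alpha> A p q w (ennreal K))) \<and>
      (w \<in> mat_class \<alpha> A p q \<longleftrightarrow> mat_const \<alpha> A p q w < \<infinity> \<and>
         maximal_ineq \<alpha> A p q w (ennreal (C * \<bar>det A\<bar> powr (1 / q)) * mat_const \<alpha> A p q w))"
    if A: "invertible A" and w: "weight w" and nz: "\<not> (AE x in lebesgue. w x = 0)"
    for A :: "real ^ 'n ^ 'n" and w :: "real ^ 'n \<Rightarrow> ennreal"
  proof -
    let ?c = "ennreal (C * \<bar>det A\<bar> powr (1 / q)) * mat_const \<alpha> A p q w"
    note converse = mat_class_of_maximal_ineq[OF A w assms(2,3) pq _ _ nz]
    have fwd: "mat_const \<alpha> A p q w < \<infinity> \<and> maximal_ineq \<alpha> A p q w ?c" if "w \<in> mat_class \<alpha> A p q"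
      using that maximal_ineq_of_mat_class[OF A w assms(2,3) pq that] mat_class_iff[OF A w assms(2,3) pq]
      unfolding C_def by (simp add: less_top)
    have "?c \<noteq> top" if "mat_const \<alpha> A p q w < \<infinity>"
      using that by (simp add: ennreal_mult_eq_top_iff)
    \<comment> \<open>A finite extended constant is a real one, which links the explicit constant to
      the existential form.\<close>
    then have fin: "?c = ennreal (enn2real ?c)" if "mat_const \<alpha> A p q w < \<infinity>"
      using that by (simp add: less_top)
    show ?thesis
    proof (intro conjI iffI)
      assume "w \<in> mat_class \<alpha> A p q"
      then show "\<exists>K::real. maximal_ineq \<alpha> A p q w (ennreal K)" using fwd fin by metis
    next
      assume "\<exists>K::real. maximal_ineq \<alpha> A p q w (ennreal K)"
      then show "w \<in> mat_class \<alpha> A p q" using converse ennreal_neq_top by blast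
    next
      assume "mat_const \<alpha> A p q w < \<infinity> \<and> maximal_ineq \<alpha> A p q w ?c"
      then show "w \<in> mat_class \<alpha> A p q" using converse fin ennreal_neq_top by metis
    qed (use fwd in blast)+
  qed
  ultimately show ?thesis by blast
qed

end
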